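(* For all integers $k \geq 1$ and $N \geq 2$, there exists $\mu \in D(A^\infty)$ such that $\langle \mu, \varphi_k \rangle = 0$ and $$a_k^1(\mu) = \cdots = a_k^{N-1}(\mu) = 0 \quad \text{and} \quad a_k^N(\mu) \neq 0.$$
   Context: All functions are real-valued. $\langle\cdot,\cdot\rangle$ is the $L^2(0,1)$ scalar product. $A = -\frac{\mathrm{d}^2}{\mathrm{d}x^2}$ is the Dirichlet Laplacian on $(0,1)$ with domain $D(A) = H^2 \cap H_0^1(0,1)$, and $D(A^\infty) = \bigcap_{n\ge0} D(A^{n/2})$. For $j\ge 1$, $\lambda_j = (j\pi)^2$ and $\varphi_j(x) = \sqrt{2}\sin(j\pi x)$. Lucas's triangle coefficients: $\begin{bmatrix} n \\ 0 \end{bmatrix} = 1$ for $n\ge0$, and $\begin{bmatrix} n \\ p \end{bmatrix} = \binom{n}{p}+\binom{n-1}{p-1}$ for $n\ge1$, $1\le p\le n$. For $k\ge 1$, $n\ge1$ and $\mu\in D(A^\infty)$, $$a_k^n(\mu) = -\frac12 \sum_{\alpha=0}^{n-1}\sum_{\beta=0}^{n-1-\alpha} (-1)^{n+\beta}\begin{bmatrix} n-1-\beta \\ \alpha \end{bmatrix}\lambda_k^{n-1-\alpha-\beta}\left\langle \mu^{(2\beta)}\mu^{(2(n-1+\alpha))},\varphi_k'\right\rangle .$$ *)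

theory Defs
  imports "HOL-Analysis.Analysis"
begin

section \<open>The space $L^2(0,1)$\<close>

text \<open>Elements of function spaces on $(0,1)$ are represented by functions on the real line;
  values outside $(0,1)$ and on null sets are irrelevant to every notion below.\<close>

abbreviation unit_measure :: "real measure"
  where "unit_measure \<equiv> lebesgue_on {0<..<1}"

definition L2 :: "(real \<Rightarrow> real) set"
  where "L2 = {f \<in> borel_measurable unit_measure. integrable unit_measure (\<lambda>x. (f x)\<^sup>2)}"

definition inner_L2 :: "(real \<Rightarrow> real) \<Rightarrow> (real \<Rightarrow> real) \<Rightarrow> real"
  where "inner_L2 f g = (LINT x|unit_measure. f x * g x)"


section \<open>Weak derivatives and Sobolev spaces on $(0,1)$\<close>

definition test_function :: "(real \<Rightarrow> real) \<Rightarrow> bool"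
  where "test_function \<psi> \<longleftrightarrow>
    (\<forall>n x. (deriv ^^ n) \<psi> differentiable (at x)) \<and>
    closure {x. \<psi> x \<noteq> 0} \<subseteq> {0<..<1}"

definition has_weak_deriv :: "nat \<Rightarrow> (real \<Rightarrow> real) \<Rightarrow> (real \<Rightarrow> real) \<Rightarrow> bool"
  where "has_weak_deriv m f g \<longleftrightarrow>
    (\<forall>\<psi>. test_function \<psi> \<longrightarrow>
      inner_L2 f ((deriv ^^ m) \<psi>) = (-1) ^ m * inner_L2 g \<psi>)"

text \<open>A weak derivative in $L^2$ is determined up to a null set, so the choice made here is
  immaterial as long as one exists.\<close>

definition weak_deriv :: "nat \<Rightarrow> (real \<Rightarrow> real) \<Rightarrow> real \<Rightarrow> real"
  where "weak_deriv m f = (SOME g. g \<in> L2 \<and> has_weak_deriv m f g)"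

definition H :: "nat \<Rightarrow> (real \<Rightarrow> real) set"
  where "H m = {f \<in> L2. \<forall>i\<le>m. \<exists>g\<in>L2. has_weak_deriv i f g}"

definition H1_norm :: "(real \<Rightarrow> real) \<Rightarrow> real"
  where "H1_norm f = sqrt (inner_L2 f f + inner_L2 (weak_deriv 1 f) (weak_deriv 1 f))"

definition H10 :: "(real \<Rightarrow> real) set"
  where "H10 = {f \<in> H 1. \<forall>\<epsilon>>0. \<exists>\<psi>. test_function \<psi> \<and> H1_norm (\<lambda>x. f x - \<psi> x) < \<epsilon>}"


section \<open>The Dirichlet Laplacian and its powers\<close>

definition ev :: "nat \<Rightarrow> real"
  where "ev j = (real j * pi)\<^sup>2"

definition ef :: "nat \<Rightarrow> real \<Rightarrow> real"
  where "ef j x = sqrt 2 * sin (real j * pi * x)"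

definition dom_A :: "(real \<Rightarrow> real) set"
  where "dom_A = H 2 \<inter> H10"

definition A :: "(real \<Rightarrow> real) \<Rightarrow> real \<Rightarrow> real"
  where "A f = (\<lambda>x. - weak_deriv 2 f x)"

text \<open>\<open>dom_A_half n\<close> is $D(A^{n/2})$. The domain of the square root is given by the functional
  calculus in the orthonormal eigenbasis \<open>ef j\<close>, $j \ge 1$, with eigenvalues \<open>ev j\<close>; the other
  powers are obtained from $A^{n/2+1} = A^{n/2} A$ with its natural domain.\<close>

fun dom_A_half :: "nat \<Rightarrow> (real \<Rightarrow> real) set"
  where
    "dom_A_half 0 = L2"
  | "dom_A_half (Suc 0) = {f \<in> L2. summable (\<lambda>i. ev (Suc i) * (inner_L2 f (ef (Suc i)))\<^sup>2)}"
  | "dom_A_half (Suc (Suc n)) = {f \<in> dom_A. A f \<in> dom_A_half n}"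

definition dom_A_inf :: "(real \<Rightarrow> real) set"
  where "dom_A_inf = (\<Inter>n. dom_A_half n)"


section \<open>Lucas's triangle and the coefficients $a_k^n(\mu)$\<close>

text \<open>Only $p = 0$, or $1 \le p \le n$, is meaningful.\<close>

definition lucas :: "nat \<Rightarrow> nat \<Rightarrow> nat"
  where "lucas n p = (if p = 0 then 1 else (n choose p) + ((n - 1) choose (p - 1)))"

text \<open>Meaningful for $n \ge 1$; no natural-number subtraction below is then truncated.
  For $\mu \in D(A^\infty)$ all weak derivatives of $\mu$ exist and agree almost everywhere
  with the classical derivatives of its smooth representative.\<close>

definition a_coeff :: "nat \<Rightarrow> nat \<Rightarrow> (real \<Rightarrow> real) \<Rightarrow> real"
  where "a_coeff k n \<mu> = - (1/2) *
    (\<Sum>\<alpha> = 0..n - 1. \<Sum>\<beta> = 0..n - 1 - \<alpha>.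
      (-1) ^ (n + \<beta>) * real (lucas (n - 1 - \<beta>) \<alpha>) * ev k ^ (n - 1 - \<alpha> - \<beta>) *
      inner_L2 (\<lambda>x. weak_deriv (2 * \<beta>) \<mu> x * weak_deriv (2 * (n - 1 + \<alpha>)) \<mu> x)
               (deriv (ef k)))"

end

theory Submission
  imports Defs
begin

text \<open>
  Every finite combination of the eigenfunctions lies in $D(A^\infty)$, and on such a $\mu$ each
  \<open>a_coeff k n\<close> is a quadratic form in the Fourier coefficients. By the product formulas for sines
  and cosines, $\langle \varphi_i \varphi_j, \varphi_k' \rangle$ vanishes unless $|i - j| = k$ or
  $i + j = k$. With the frequencies $k(u+2)$, $0 \le u \le d + 1$, only neighbours $u$, $u + 1$
  interact, $i + j = k$ is impossible, and $\varphi_k$ itself does not occur. Hence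
  \[ a_k^{m+1}(\mu) = \textit{const} \cdot \lambda_k^{2m} \sum_{u \le d} c_u c_{u+1} Q_m(u) \]
  with a positive constant that does not depend on $m$ and a polynomial $Q_m$ (lemma
  \<open>a_coeff_sine_sum\<close>). The two eigenvalues that occur are $\lambda_k (u+2)^2$ and
  $\lambda_k (u+3)^2$, so $Q_m$ has degree at most $4m$, and its coefficient at $4m$ is twice the
  alternating sum of the diagonal entries $1, 2, 2, \dots$ of Lucas's triangle, which is $\pm 1$.

  The consecutive products $c_u c_{u+1}$ can be prescribed to be any nonzero reals. For
  $d = 4(N-1)$ they are taken to be $(-1)^u \binom{d}{u}$. The sum is then a $d$-th finite
  difference of $Q_m$: it kills every polynomial of degree below $d$, hence all $a_k^n$ with
  $n < N$, but not $Q_{N-1}$, whose degree is exactly $d$.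

  The analytic part connects this computation with weak derivatives and with the domains of the
  powers of the operator. Smooth cutoff functions built from $e^{-1/t}$ give two things. First,
  an integrable function orthogonal to all test functions vanishes almost everywhere, so the weak
  derivatives of a sine sum are its classical ones. Second, a smooth function that vanishes at $0$
  and $1$ is a limit of test functions in $H^1$, so sine sums belong to $H_0^1$.
\<close>

section \<open>Smooth functions on the real line\<close>

text \<open>Smoothness is graded by the number of derivatives, so that closure under products and the like is
  a plain induction on that number, with no Leibniz formula for iterated derivatives.\<close>

fun diff_times :: "nat \<Rightarrow> (real \<Rightarrow> real) \<Rightarrow> bool"
  where
    "diff_times 0 f \<longleftrightarrow> True"
  | "diff_times (Suc n) f \<longleftrightarrow> (\<exists>f'. (\<forall>x. (f has_real_derivative f' x) (at x)) \<and> diff_times n f')"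

definition smooth :: "(real \<Rightarrow> real) \<Rightarrow> bool"
  where "smooth f \<longleftrightarrow> (\<forall>n. diff_times n f)"

lemma diff_times_SucI:
  "(\<And>x. (f has_real_derivative f' x) (at x)) \<Longrightarrow> diff_times n f' \<Longrightarrow> diff_times (Suc n) f"
  by auto

lemma diff_times_SucD: "diff_times (Suc n) f \<Longrightarrow> diff_times n f"
proof (induction n arbitrary: f)
  case (Suc n)
  then show ?case by (metis diff_times.simps(2))
qed simp

lemma diff_times_add: "diff_times n f \<Longrightarrow> diff_times n g \<Longrightarrow> diff_times n (\<lambda>x. f x + g x)"
proof (induction n arbitrary: f g)
  case (Suc n)
  then obtain f' g' where
    "\<And>x. (f has_real_derivative f' x) (at x)" "diff_times n f'"
    "\<And>x. (g has_real_derivative g' x) (at x)" "diff_times n g'" by auto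
  with Suc.IH show ?case by (auto intro!: exI[of _ "\<lambda>x. f' x + g' x"] derivative_intros)
qed simp

lemma diff_times_mult: "diff_times n f \<Longrightarrow> diff_times n g \<Longrightarrow> diff_times n (\<lambda>x. f x * g x)"
proof (induction n arbitrary: f g)
  case (Suc n)
  then obtain f' g' where
    f: "\<And>x. (f has_real_derivative f' x) (at x)" "diff_times n f'" and
    g: "\<And>x. (g has_real_derivative g' x) (at x)" "diff_times n g'" by auto
  have "diff_times n (\<lambda>x. f' x * g x + g' x * f x)"
    using Suc diff_times_SucD f g by (intro diff_times_add Suc.IH) auto
  with f g show ?case
    by (auto intro!: exI[of _ "\<lambda>x. f' x * g x + g' x * f x"] derivative_eq_intros)
qed simp

lemma diff_times_affine: "diff_times n f \<Longrightarrow> diff_times n (\<lambda>x. c * f (a * x + b))"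
proof (induction n arbitrary: f c)
  case (Suc n)
  then obtain f' where f: "\<And>x. (f has_real_derivative f' x) (at x)" "diff_times n f'" by auto
  have "((\<lambda>x. c * f (a * x + b)) has_real_derivative (c * a) * f' (a * x + b)) (at x)" for x
    by (auto intro!: derivative_eq_intros DERIV_chain2[OF f(1)])
  moreover have "diff_times n (\<lambda>x. (c * a) * f' (a * x + b))" using Suc.IH f by blast
  ultimately show ?case by (rule diff_times_SucI)
qed simp

lemma smooth_add: "smooth f \<Longrightarrow> smooth g \<Longrightarrow> smooth (\<lambda>x. f x + g x)"
  by (simp add: smooth_def diff_times_add)

lemma smooth_mult: "smooth f \<Longrightarrow> smooth g \<Longrightarrow> smooth (\<lambda>x. f x * g x)"
  by (simp add: smooth_def diff_times_mult)

lemma smooth_affine: "smooth f \<Longrightarrow> smooth (\<lambda>x. c * f (a * x + b))"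
  by (simp add: smooth_def diff_times_affine)

lemma smooth_const: "smooth (\<lambda>x. c)"
proof -
  have "diff_times n (\<lambda>x. c)" for n
    by (induction n arbitrary: c) (auto intro!: exI[of _ "\<lambda>x. 0"])
  then show ?thesis by (simp add: smooth_def)
qed

lemma smooth_scale: "smooth f \<Longrightarrow> smooth (\<lambda>x. c * f x)"
  using smooth_mult[OF smooth_const] .

lemma smooth_diff: "smooth f \<Longrightarrow> smooth g \<Longrightarrow> smooth (\<lambda>x. f x - g x)"
  using smooth_add[OF _ smooth_scale[of g "-1"], of f] by simp

lemma smooth_sum: "(\<And>i. i \<in> I \<Longrightarrow> smooth (f i)) \<Longrightarrow> smooth (\<lambda>x. \<Sum>i\<in>I. f i x)"
  by (induction I rule: infinite_finite_induct) (auto intro: smooth_add smooth_const)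

lemma smooth_DERIV: "smooth f \<Longrightarrow> (f has_real_derivative deriv f x) (at x)"
proof -
  assume "smooth f"
  then have "diff_times (Suc 0) f" unfolding smooth_def by blast
  then obtain f' where "\<And>x. (f has_real_derivative f' x) (at x)" by auto
  from this[of x] show ?thesis by (metis DERIV_imp_deriv)
qed

lemma smooth_deriv: "smooth f \<Longrightarrow> smooth (deriv f)"
proof -
  assume f: "smooth f"
  have "diff_times n (deriv f)" for n
  proof -
    obtain f' where "\<And>x. (f has_real_derivative f' x) (at x)" "diff_times n f'"
      using f unfolding smooth_def by (metis diff_times.simps(2))
    moreover from this have "deriv f = f'" by (auto simp: DERIV_imp_deriv)
    ultimately show ?thesis by simp
  qed
  then show ?thesis by (simp add: smooth_def)
qed

lemma smooth_deriv_iterate: "smooth f \<Longrightarrow> smooth ((deriv ^^ n) f)"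
  by (induction n) (auto intro: smooth_deriv)

lemma smooth_continuous: "smooth f \<Longrightarrow> continuous_on S f"
  by (meson DERIV_continuous_on smooth_DERIV has_field_derivative_at_within)

lemma smooth_iff_differentiable_iterates:
  "smooth f \<longleftrightarrow> (\<forall>n x. (deriv ^^ n) f differentiable (at x))"
proof
  assume "smooth f"
  then show "\<forall>n x. (deriv ^^ n) f differentiable (at x)"
    using smooth_deriv_iterate smooth_DERIV real_differentiable_def by blast
next
  assume d: "\<forall>n x. (deriv ^^ n) f differentiable (at x)"
  have "diff_times m ((deriv ^^ i) f)" for m i
  proof (induction m arbitrary: i)
    case (Suc m)
    have "((deriv ^^ i) f has_real_derivative (deriv ^^ Suc i) f x) (at x)" for x
      using d by (auto simp: DERIV_deriv_iff_real_differentiable)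
    then show ?case using Suc by (auto intro!: exI[of _ "(deriv ^^ Suc i) f"])
  qed simp
  from this[of _ 0] show "smooth f" by (simp add: smooth_def)
qed

text \<open>Both a sine and a cosine term are present because the derivative of such a combination is again one.\<close>

lemma smooth_trig: "smooth (\<lambda>x. a * sin (w * x) + b * cos (w * x))"
proof -
  have "diff_times n (\<lambda>x. a * sin (w * x) + b * cos (w * x))" for n
  proof (induction n arbitrary: a b)
    case (Suc n)
    have "((\<lambda>x. a * sin (w * x) + b * cos (w * x)) has_real_derivative
        (- (b * w)) * sin (w * x) + (a * w) * cos (w * x)) (at x)" for x
      by (auto intro!: derivative_eq_intros simp: algebra_simps)
    with Suc[of "- (b * w)" "a * w"] show ?case
      by (auto intro!: exI[of _ "\<lambda>x. (- (b * w)) * sin (w * x) + (a * w) * cos (w * x)"])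
  qed simp
  then show ?thesis by (simp add: smooth_def)
qed

section \<open>Smooth cutoff functions\<close>

text \<open>The family $t^{-k} e^{-1/t}$, extended by $0$ to $t \le 0$, spans a space closed under
  differentiation. The member $k = 0$ is the classical smooth function that is flat at $0$.\<close>

definition flat_exp :: "nat \<Rightarrow> real \<Rightarrow> real"
  where "flat_exp k t = (if t > 0 then exp (- (1 / t)) / t ^ k else 0)"

lemma flat_exp_tendsto_0: "(flat_exp k \<longlongrightarrow> 0) (at 0)"
proof -
  have "((\<lambda>t. inverse t ^ k / exp (inverse t)) \<longlongrightarrow> (0::real)) (at_right 0)"
    by (rule filterlim_compose[OF tendsto_power_div_exp_0 filterlim_inverse_at_top_right])
  then have "(flat_exp k \<longlongrightarrow> 0) (at_right 0)"
    by (rule Lim_transform_eventually)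
       (auto simp: eventually_at_filter flat_exp_def exp_minus field_simps)
  moreover have "(flat_exp k \<longlongrightarrow> 0) (at_left 0)"
    by (rule Lim_transform_eventually[OF tendsto_const])
       (auto simp: eventually_at_filter flat_exp_def)
  ultimately show ?thesis by (simp add: filterlim_at_split)
qed

lemma DERIV_flat_exp:
  "(flat_exp k has_real_derivative - real k * flat_exp (Suc k) x + flat_exp (k + 2) x) (at x)"
proof (cases x "0::real" rule: linorder_cases)
  case less
  have "((\<lambda>_. 0) has_real_derivative 0) (at x)" by simp
  then have "(flat_exp k has_real_derivative 0) (at x)"
    by (rule has_field_derivative_transform_within_open[of _ _ _ "{..<0}"])
       (use less in \<open>auto simp: flat_exp_def\<close>)
  then show ?thesis using less by (simp add: flat_exp_def)
next
  case greater
  have "((\<lambda>t. exp (- (1 / t)) / t ^ k) has_real_derivative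
      - real k * flat_exp (Suc k) x + flat_exp (k + 2) x) (at x)"
  proof (cases k)
    case 0
    then show ?thesis using greater
      by (auto intro!: derivative_eq_intros simp: flat_exp_def field_simps power2_eq_square)
  next
    case (Suc m)
    have "((\<lambda>t. exp (- (1 / t)) / t ^ k) has_real_derivative
        (exp (- (1 / x)) * (1 / x\<^sup>2) * x ^ k - exp (- (1 / x)) * (real k * x ^ (k - Suc 0))) / (x ^ k * x ^ k)) (at x)"
      using greater by (auto intro!: derivative_eq_intros simp: power2_eq_square)
    also have "(exp (- (1 / x)) * (1 / x\<^sup>2) * x ^ k - exp (- (1 / x)) * (real k * x ^ (k - Suc 0))) / (x ^ k * x ^ k)
      = - real k * flat_exp (Suc k) x + flat_exp (k + 2) x"
      using greater Suc by (simp add: flat_exp_def field_simps power2_eq_square)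
    finally show ?thesis .
  qed
  then show ?thesis
    by (rule has_field_derivative_transform_within_open[of _ _ _ "{0<..}"])
       (use greater in \<open>auto simp: flat_exp_def\<close>)
next
  case equal
  have "((\<lambda>h. (flat_exp k (0 + h) - flat_exp k 0) / h) \<longlongrightarrow> 0) (at 0)"
    by (rule Lim_transform_eventually[OF flat_exp_tendsto_0[of "Suc k"]])
       (auto simp: flat_exp_def eventually_at_filter)
  then show ?thesis using equal by (simp add: DERIV_def flat_exp_def)
qed

lemma smooth_flat_exp: "smooth (flat_exp k)"
proof -
  have "diff_times n (\<lambda>x. c * flat_exp k (1 * x + 0))" for n c
  proof (induction n arbitrary: k c)
    case (Suc n)
    have "diff_times n (\<lambda>x. - real k * flat_exp (Suc k) x + flat_exp (k + 2) x)"
      using diff_times_add[OF Suc[of "- real k" "Suc k"] Suc[of 1 "k + 2"]] by simp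
    then have "diff_times (Suc n) (flat_exp k)"
      by (rule diff_times_SucI[OF DERIV_flat_exp])
    then show ?case by (rule diff_times_affine)
  qed simp
  from this[of _ 1] show ?thesis by (simp add: smooth_def)
qed

lemma flat_exp_0_bounds: "0 \<le> flat_exp 0 t" "flat_exp 0 t \<le> 1"
  by (auto simp: flat_exp_def)

section \<open>Integration on the unit interval and weak derivatives of smooth functions\<close>

lemma unit_AE_iff: "(AE x in unit_measure. P x) \<longleftrightarrow> (AE x in lebesgue. x \<in> {0<..<1} \<longrightarrow> P x)"
  by (subst AE_restrict_space_iff) auto

lemma unit_AE_I: "(\<And>x. 0 < x \<Longrightarrow> x < 1 \<Longrightarrow> P x) \<Longrightarrow> AE x in unit_measure. P x"
  by (simp add: unit_AE_iff)

lemma finite_unit_measure: "finite_measure unit_measure"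
  by (intro finite_measureI) (simp add: emeasure_restrict_space)

lemma integrable_unit_continuous:
  assumes "continuous_on {0..1} f"
  shows "integrable unit_measure (f :: real \<Rightarrow> real)"
proof -
  have "f absolutely_integrable_on {0..1}"
    by (rule absolutely_integrable_continuous_real[OF assms])
  then have "f absolutely_integrable_on {0<..<1}"
    by (rule set_integrable_subset) auto
  then show ?thesis
    by (simp add: integrable_restrict_space set_integrable_def)
qed

lemma unit_integral_eq_integral:
  assumes "continuous_on {0..1} f"
  shows "(LINT x|unit_measure. f x) = integral {0..1} (f :: real \<Rightarrow> real)"
  by (subst lebesgue_integral_eq_integral[OF integrable_unit_continuous[OF assms]])
     (simp_all add: integral_open_interval_real)

lemma unit_integral_deriv:
  assumes "\<And>x. (F has_real_derivative f x) (at x)" "continuous_on {0..1} f"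
  shows "(LINT x|unit_measure. f x) = F 1 - F 0"
proof -
  have "(f has_integral F 1 - F 0) {0..1}"
    using assms(1) by (intro fundamental_theorem_of_calculus)
      (auto simp: has_real_derivative_iff_has_vector_derivative[symmetric]
            intro: has_field_derivative_at_within)
  then show ?thesis by (simp add: unit_integral_eq_integral[OF assms(2)] integral_unique)
qed

lemma L2_AE_cong:
  assumes "f \<in> L2" "AE x in unit_measure. g x = f x" "g \<in> borel_measurable unit_measure"
  shows "g \<in> L2"
proof -
  have "AE x in unit_measure. (f x)\<^sup>2 = (g x)\<^sup>2"
    using assms(2) by eventually_elim simp
  moreover have "integrable unit_measure (\<lambda>x. (f x)\<^sup>2)"
    using assms(1) by (simp add: L2_def)
  moreover have "(\<lambda>x. (g x)\<^sup>2) \<in> borel_measurable unit_measure"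
    using assms(3) by (rule borel_measurable_power)
  ultimately have "integrable unit_measure (\<lambda>x. (g x)\<^sup>2)"
    by (rule integrable_cong_AE_imp[rotated 2])
  then show ?thesis using assms(3) by (simp add: L2_def)
qed

lemma L2_integrable:
  assumes "f \<in> L2" shows "integrable unit_measure f"
proof (rule Bochner_Integration.integrable_bound)
  show "integrable unit_measure (\<lambda>x. 1 + (f x)\<^sup>2)"
    using assms finite_measure.integrable_const[OF finite_unit_measure]
    by (intro Bochner_Integration.integrable_add) (auto simp: L2_def)
  have "\<bar>t\<bar> \<le> 1 + t\<^sup>2" for t :: real
    using zero_le_power2[of "\<bar>t\<bar> - 1/2"] by (simp add: power2_eq_square algebra_simps)
  then show "AE x in unit_measure. norm (f x) \<le> norm (1 + (f x)\<^sup>2)" by simp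
qed (use assms in \<open>simp add: L2_def\<close>)

lemma smooth_measurable: "smooth f \<Longrightarrow> f \<in> borel_measurable unit_measure"
  using borel_measurable_integrable integrable_unit_continuous smooth_continuous by blast

lemma smooth_L2: "smooth f \<Longrightarrow> f \<in> L2"
  unfolding L2_def using smooth_measurable
  by (blast intro: integrable_unit_continuous continuous_on_power smooth_continuous)

lemma smooth_bounded:
  assumes "smooth f" shows "\<exists>B. \<forall>x\<in>{0..1}. \<bar>f x\<bar> \<le> B"
proof -
  have "compact (f ` {0..1})"
    by (intro compact_continuous_image smooth_continuous assms) auto
  then show ?thesis by (auto dest!: compact_imp_bounded simp: bounded_iff)
qed

lemma integrable_times_smooth:
  assumes "integrable unit_measure f" "smooth g"
  shows "integrable unit_measure (\<lambda>x. f x * g x)"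
proof -
  obtain B where B: "\<And>x. x\<in>{0..1} \<Longrightarrow> \<bar>g x\<bar> \<le> B" using smooth_bounded[OF assms(2)] by blast
  show ?thesis
  proof (rule Bochner_Integration.integrable_bound[of _ "\<lambda>x. B * f x"])
    show "AE x in unit_measure. norm (f x * g x) \<le> norm (B * f x)"
    proof (rule unit_AE_I)
      fix x :: real assume "0 < x" "x < 1"
      then show "norm (f x * g x) \<le> norm (B * f x)"
        using B[of x] mult_right_mono[of "\<bar>g x\<bar>" "\<bar>B\<bar>" "\<bar>f x\<bar>"] by (auto simp: abs_mult mult.commute)
    qed
  qed (use assms smooth_measurable in auto)
qed

lemma inner_L2_AE_cong:
  assumes "AE x in unit_measure. f x = g x"
    "f \<in> borel_measurable unit_measure" "g \<in> borel_measurable unit_measure" "h \<in> borel_measurable unit_measure"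
  shows "inner_L2 f h = inner_L2 g h"
  unfolding inner_L2_def
proof (rule integral_cong_AE)
  show "AE x in unit_measure. f x * h x = g x * h x"
    using assms(1) by eventually_elim simp
qed (intro borel_measurable_times assms)+

lemma test_function_iff: "test_function \<psi> \<longleftrightarrow> smooth \<psi> \<and> closure {x. \<psi> x \<noteq> 0} \<subseteq> {0<..<1}"
  by (auto simp: test_function_def smooth_iff_differentiable_iterates)

lemma test_function_zero_outside:
  assumes "test_function \<psi>" "x \<le> 0 \<or> x \<ge> 1" shows "\<psi> x = 0"
  using assms closure_subset[of "{x. \<psi> x \<noteq> 0}"] by (fastforce simp: test_function_iff)

lemma test_function_deriv:
  assumes "test_function \<psi>" shows "test_function (deriv \<psi>)"
proof -
  have "{x. deriv \<psi> x \<noteq> 0} \<subseteq> closure {x. \<psi> x \<noteq> 0}"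
  proof (rule subsetI, rule ccontr)
    fix x assume x: "x \<in> {x. deriv \<psi> x \<noteq> 0}" "x \<notin> closure {x. \<psi> x \<noteq> 0}"
    have "((\<lambda>_. 0) has_real_derivative 0) (at x)" by simp
    then have "(\<psi> has_real_derivative 0) (at x)"
      by (rule has_field_derivative_transform_within_open[of _ _ _ "- closure {x. \<psi> x \<noteq> 0}"])
         (use x closure_subset[of "{x. \<psi> x \<noteq> 0}"] in auto)
    then show False using x by (simp add: DERIV_imp_deriv)
  qed
  then have "closure {x. deriv \<psi> x \<noteq> 0} \<subseteq> closure {x. \<psi> x \<noteq> 0}"
    by (simp add: closure_minimal)
  with assms show ?thesis by (auto simp: test_function_iff smooth_deriv)
qed

text \<open>Integration by parts: the boundary terms disappear because a test function vanishes at both end points.\<close>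

lemma smooth_has_weak_deriv:
  assumes "smooth f" shows "has_weak_deriv m f ((deriv ^^ m) f)"
proof -
  have *: "inner_L2 ((deriv ^^ m) f) (deriv \<psi>) = - inner_L2 ((deriv ^^ Suc m) f) \<psi>"
    if "test_function \<psi>" for \<psi> m
  proof -
    let ?f = "(deriv ^^ m) f"
    have sm: "smooth ?f" "smooth \<psi>" "smooth (deriv ?f)" "smooth (deriv \<psi>)"
      using that assms smooth_deriv_iterate by (auto simp: test_function_iff intro: smooth_deriv)
    have "(LINT x|unit_measure. deriv ?f x * \<psi> x + ?f x * deriv \<psi> x) = ?f 1 * \<psi> 1 - ?f 0 * \<psi> 0"
      using sm by (intro unit_integral_deriv continuous_intros smooth_continuous)
        (auto intro!: derivative_eq_intros smooth_DERIV)
    moreover have "integrable unit_measure (\<lambda>x. deriv ?f x * \<psi> x)"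
        "integrable unit_measure (\<lambda>x. ?f x * deriv \<psi> x)"
      using sm by (auto intro!: integrable_unit_continuous smooth_continuous smooth_mult)
    ultimately show ?thesis
      using test_function_zero_outside[OF that] by (simp add: inner_L2_def)
  qed
  have "inner_L2 f ((deriv ^^ m) \<psi>) = (-1) ^ m * inner_L2 ((deriv ^^ m) f) \<psi>"
    if "test_function \<psi>" for \<psi>
    using that
  proof (induction m arbitrary: \<psi>)
    case (Suc m)
    have "inner_L2 f ((deriv ^^ Suc m) \<psi>) = inner_L2 f ((deriv ^^ m) (deriv \<psi>))"
      by (simp add: funpow_swap1)
    also have "\<dots> = (-1) ^ m * inner_L2 ((deriv ^^ m) f) (deriv \<psi>)"
      using Suc test_function_deriv by blast
    finally show ?case using *[OF Suc.prems, of m] by simp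
  qed simp
  then show ?thesis by (simp add: has_weak_deriv_def)
qed

section \<open>Uniqueness of weak derivatives\<close>

text \<open>The support is contained in $[1/n, 1 - 1/n]$, so multiplying any smooth function by this one
  gives a test function, and the values tend to $1$ everywhere in $(0,1)$.\<close>

definition cutoff :: "nat \<Rightarrow> real \<Rightarrow> real"
  where "cutoff n x = flat_exp 0 (real n * x - 1) * flat_exp 0 (real n * (1 - x) - 1)"

lemma smooth_cutoff: "smooth (cutoff n)"
proof -
  have "smooth (\<lambda>x. (1 * flat_exp 0 (real n * x + (- 1))) * (1 * flat_exp 0 ((- real n) * x + (real n - 1))))"
    by (intro smooth_mult smooth_affine smooth_flat_exp)
  then show ?thesis by (simp add: cutoff_def[abs_def] algebra_simps)
qed

lemma test_function_cutoff:
  assumes "smooth f" shows "test_function (\<lambda>x. f x * cutoff n x)"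
proof -
  \<comment> \<open>\<open>Suc n\<close> instead of \<open>n\<close> keeps the fractions meaningful for \<open>n = 0\<close>, where the cutoff is zero.\<close>
  have "{x. f x * cutoff n x \<noteq> 0} \<subseteq> {1 / Suc n .. 1 - 1 / Suc n}"
  proof
    fix x assume "x \<in> {x. f x * cutoff n x \<noteq> 0}"
    then have *: "real n * x > 1" "real n * (1 - x) > 1"
      by (auto simp: cutoff_def flat_exp_def split: if_splits)
    then have "0 < real n" by (metis less_eq_real_def mult_zero_left not_one_less_zero of_nat_0_le_iff)
    with * have "x > 0" "1 - x > 0" by (smt (verit) mult_nonneg_nonpos)+
    with * have "real (Suc n) * x \<ge> 1" "real (Suc n) * (1 - x) \<ge> 1" by (auto simp: algebra_simps)
    then show "x \<in> {1 / Suc n .. 1 - 1 / Suc n}" by (auto simp: field_simps)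
  qed
  then have "closure {x. f x * cutoff n x \<noteq> 0} \<subseteq> {1 / Suc n .. 1 - 1 / Suc n}"
    by (simp add: closure_minimal)
  also have "\<dots> \<subseteq> {0<..<1}"
  proof -
    have "{e..1 - e} \<subseteq> {0<..<1}" if "e > 0" for e :: real using that by auto
    from this[of "1 / Suc n"] show ?thesis by simp
  qed
  finally show ?thesis using assms by (simp add: test_function_iff smooth_mult smooth_cutoff)
qed

lemma cutoff_bounds: "0 \<le> cutoff n x" "cutoff n x \<le> 1"
  using flat_exp_0_bounds by (auto simp: cutoff_def intro!: mult_le_one)

lemma flat_exp_0_tendsto_1: "(flat_exp 0 \<longlongrightarrow> 1) at_top"
proof -
  have "((\<lambda>t::real. exp (- (1 / t))) \<longlongrightarrow> exp (- 0)) at_top"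
    by (intro tendsto_intros tendsto_divide_0[OF tendsto_const] filterlim_at_top_imp_at_infinity filterlim_ident)
  then show ?thesis
    unfolding minus_zero exp_zero
    by (rule tendsto_cong[THEN iffD1, rotated])
       (use eventually_gt_at_top[of 0] in \<open>auto simp: flat_exp_def elim!: eventually_mono\<close>)
qed

lemma cutoff_tendsto:
  assumes "0 < x" "x < 1" shows "(\<lambda>n. cutoff n x) \<longlonglongrightarrow> 1"
proof -
  have "filterlim (\<lambda>n. real n * y - 1) at_top sequentially" if "y > 0" for y
    using filterlim_tendsto_add_at_top[OF tendsto_const[of "-1"]
        filterlim_at_top_mult_tendsto_pos[OF tendsto_const that filterlim_real_sequentially]]
    by simp
  from this[of x] this[of "1 - x"] assms
  have "(\<lambda>n. flat_exp 0 (real n * x - 1) * flat_exp 0 (real n * (1 - x) - 1)) \<longlonglongrightarrow> 1 * 1"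
    by (intro tendsto_mult filterlim_compose[OF flat_exp_0_tendsto_1]) auto
  then show ?thesis by (simp add: cutoff_def)
qed

text \<open>The products of \<open>f\<close> with the cutoff functions are test functions converging to \<open>f\<close>, and dominated
  convergence applies.\<close>

lemma integral_times_smooth_eq_0:
  assumes h: "integrable unit_measure h"
    and 0: "\<And>\<psi>. test_function \<psi> \<Longrightarrow> inner_L2 h \<psi> = 0" and f: "smooth f"
  shows "(LINT x|unit_measure. h x * f x) = 0"
proof -
  have "(\<lambda>n. LINT x|unit_measure. h x * (f x * cutoff n x)) \<longlonglongrightarrow> (LINT x|unit_measure. h x * f x)"
  proof (rule integral_dominated_convergence[where w = "\<lambda>x. \<bar>h x * f x\<bar>"])
    show "AE x in unit_measure. (\<lambda>n. h x * (f x * cutoff n x)) \<longlonglongrightarrow> h x * f x"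
    proof (rule unit_AE_I)
      fix x :: real assume "0 < x" "x < 1"
      then have "(\<lambda>n. h x * (f x * cutoff n x)) \<longlonglongrightarrow> h x * (f x * 1)"
        by (intro tendsto_intros cutoff_tendsto)
      then show "(\<lambda>n. h x * (f x * cutoff n x)) \<longlonglongrightarrow> h x * f x" by simp
    qed
    show "AE x in unit_measure. norm (h x * (f x * cutoff n x)) \<le> \<bar>h x * f x\<bar>" for n
    proof (rule AE_I2)
      fix x
      show "norm (h x * (f x * cutoff n x)) \<le> \<bar>h x * f x\<bar>"
        using cutoff_bounds[of n x] mult_left_mono[of "cutoff n x" 1 "\<bar>h x * f x\<bar>"]
        by (simp add: abs_mult mult_ac)
    qed
    show "integrable unit_measure (\<lambda>x. \<bar>h x * f x\<bar>)"
      using integrable_times_smooth[OF h f] by simp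
    show "(\<lambda>x. h x * f x) \<in> borel_measurable unit_measure"
      using integrable_times_smooth[OF h f] by (rule borel_measurable_integrable)
    show "(\<lambda>x. h x * (f x * cutoff n x)) \<in> borel_measurable unit_measure" for n
      by (rule borel_measurable_integrable[OF integrable_times_smooth[OF h smooth_mult[OF f smooth_cutoff]]])
  qed
  moreover have "(LINT x|unit_measure. h x * (f x * cutoff n x)) = 0" for n
    using 0[OF test_function_cutoff[OF f]] by (simp add: inner_L2_def)
  ultimately show ?thesis by (simp add: LIMSEQ_const_iff)
qed

text \<open>A smooth approximation of the indicator of $[0, \infty)$. The transition is shifted to $-1/n$, and
  the scale $n^2$ then makes the limit at $0$ equal to $1$.\<close>

definition soft_step :: "nat \<Rightarrow> real \<Rightarrow> real"
  where "soft_step n t = flat_exp 0 ((real n)\<^sup>2 * t + real n)"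

lemma soft_step_tendsto: "(\<lambda>n. soft_step n t) \<longlonglongrightarrow> (if t \<ge> 0 then 1 else 0)"
proof (cases "t \<ge> 0")
  case True
  have "filterlim (\<lambda>n. (real n)\<^sup>2 * t + real n) at_top sequentially"
    by (rule filterlim_at_top_mono[OF filterlim_real_sequentially]) (use True in auto)
  with True show ?thesis
    unfolding soft_step_def by (simp add: filterlim_compose[OF flat_exp_0_tendsto_1])
next
  case False
  obtain m :: nat where m: "real m * (- t) > 1"
    using False reals_Archimedean3[of "- t", rule_format, of 1] by auto
  have "soft_step n t = 0" if "n \<ge> m" for n
  proof -
    have "real m * (- t) \<le> real n * (- t)" using that False by (intro mult_right_mono) auto
    then have "real n * (real n * t + 1) \<le> 0" using m by (intro mult_nonneg_nonpos) auto
    then show ?thesis by (simp add: soft_step_def flat_exp_def power2_eq_square algebra_simps)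
  qed
  then have "eventually (\<lambda>n. soft_step n t = 0) sequentially"
    by (auto simp: eventually_sequentially)
  with False show ?thesis by (simp add: tendsto_eventually)
qed

lemma smooth_soft_step: "smooth (\<lambda>x. soft_step n (a * x + b))"
proof -
  have "smooth (\<lambda>x. 1 * flat_exp 0 (((real n)\<^sup>2 * a) * x + ((real n)\<^sup>2 * b + real n)))"
    by (intro smooth_affine smooth_flat_exp)
  then show ?thesis by (simp add: soft_step_def algebra_simps)
qed

text \<open>Products of a rising and a falling soft step are smooth and converge to the indicator of the
  interval.\<close>

lemma interval_integral_eq_0:
  assumes h: "integrable unit_measure h"
    and 0: "\<And>\<psi>. test_function \<psi> \<Longrightarrow> inner_L2 h \<psi> = 0"
  shows "(LINT x|unit_measure. h x * indicator {a..b} x) = 0"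
proof -
  define f where "f n x = soft_step n (1 * x + (- a)) * soft_step n (- 1 * x + b)" for n x
  have f: "smooth (f n)" for n
    unfolding f_def[abs_def] by (intro smooth_mult smooth_soft_step)
  have b: "0 \<le> f n x" "f n x \<le> 1" for n x
    using flat_exp_0_bounds by (auto simp: f_def soft_step_def intro!: mult_le_one)
  have "(\<lambda>n. LINT x|unit_measure. h x * f n x) \<longlonglongrightarrow> (LINT x|unit_measure. h x * indicator {a..b} x)"
  proof (rule integral_dominated_convergence[where w = "\<lambda>x. \<bar>h x\<bar>"])
    show "AE x in unit_measure. (\<lambda>n. h x * f n x) \<longlonglongrightarrow> h x * indicator {a..b} x"
    proof (rule AE_I2)
      fix x
      have "(\<lambda>n. h x * f n x) \<longlonglongrightarrow>
          h x * ((if 1 * x + (- a) \<ge> 0 then 1 else 0) * (if - 1 * x + b \<ge> 0 then 1 else 0))"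
        unfolding f_def by (intro tendsto_intros soft_step_tendsto)
      then show "(\<lambda>n. h x * f n x) \<longlonglongrightarrow> h x * indicator {a..b} x"
        by (simp add: indicator_def if_distrib cong: if_cong) (auto split: if_splits)
    qed
    show "AE x in unit_measure. norm (h x * f n x) \<le> \<bar>h x\<bar>" for n
      using b by (intro AE_I2) (simp add: abs_mult mult_left_le)
    show "integrable unit_measure (\<lambda>x. \<bar>h x\<bar>)" using h by simp
    show "(\<lambda>x. h x * f n x) \<in> borel_measurable unit_measure" for n
      by (rule borel_measurable_integrable[OF integrable_times_smooth[OF h f]])
    have "indicator {a..b} \<in> borel_measurable unit_measure"
      by (intro measurable_restrict_space1 borel_measurable_indicator) simp
    then show "(\<lambda>x. h x * indicator {a..b} x) \<in> borel_measurable unit_measure"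
      using h by (intro borel_measurable_times) auto
  qed
  moreover have "(LINT x|unit_measure. h x * f n x) = 0" for n
    by (rule integral_times_smooth_eq_0[OF h 0 f])
  ultimately show ?thesis by (simp add: LIMSEQ_const_iff)
qed

text \<open>Sets over which the integral vanishes form a Dynkin system that contains the closed intervals, hence
  all Borel sets; null sets extend this to all Lebesgue measurable sets.\<close>

lemma zero_AE_if_interval_integrals_zero:
  fixes g :: "real \<Rightarrow> real"
  assumes g: "integrable lebesgue g" and int: "\<And>a b. (LINT x:{a..b}|lebesgue. g x) = 0"
    and UNIV: "(LINT x|lebesgue. g x) = 0"
  shows "AE x in lebesgue. g x = 0"
proof -
  have si: "set_integrable lebesgue A g" if "A \<in> sets lebesgue" for A
    using integrable_mult_indicator[OF that g] by (simp add: set_integrable_def)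
  have borel: "(LINT x:A|lebesgue. g x) = 0" if "A \<in> sets borel" for A
    using that
  proof (induction rule: borel_set_induct)
    case empty
    show ?case by (simp add: set_lebesgue_integral_def)
  next
    case (interval a b)
    show ?case by (rule int)
  next
    case (compl A)
    then have A: "A \<in> sets lebesgue" "- A \<in> sets lebesgue" by auto
    have "(LINT x:A \<union> (- A)|lebesgue. g x) = (LINT x:A|lebesgue. g x) + (LINT x:- A|lebesgue. g x)"
      by (rule set_integral_Un) (use A si in auto)
    with compl UNIV show ?case by (simp add: set_lebesgue_integral_def)
  next
    case (union f)
    then have m: "f i \<in> sets lebesgue" for i by auto
    have "(LINT x:(\<Union>i. f i)|lebesgue. g x) = (\<Sum>i. LINT x:f i|lebesgue. g x)"
    proof (rule lebesgue_integral_countable_add[OF m])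
      show "f i \<inter> f j = {}" if "i \<noteq> j" for i j
        using union that by (auto simp: disjoint_family_on_def)
      show "set_integrable lebesgue (\<Union> (range f)) g" using m by (intro si) auto
    qed
    with union show ?case by simp
  qed
  have leb: "(LINT x:S|lebesgue. g x) = 0" if S: "S \<in> sets lebesgue" for S
  proof -
    obtain C T where C: "fsigma C" "T \<in> null_sets lebesgue" "C \<union> T = S" "disjnt C T"
      using lebesgue_set_almost_fsigma[OF S] .
    have Cb: "C \<in> sets borel" using C(1) by (cases rule: fsigma.cases) auto
    have "(LINT x:S|lebesgue. g x) = (LINT x:C|lebesgue. g x)"
    proof (rule set_integral_null_delta[OF g S])
      have "(S - C) \<union> (C - S) = T" using C by (auto simp: disjnt_def)
      then show "(S - C) \<union> (C - S) \<in> null_sets lebesgue" using C by simp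
    qed (use Cb in auto)
    with borel[OF Cb] show ?thesis by simp
  qed
  show ?thesis
    by (rule density_unique_real[OF g integrable_zero]) (simp add: leb)
qed

text \<open>The fundamental lemma of the calculus of variations: orthogonality passes from test functions to
  indicators of intervals, and these determine an integrable function up to null sets.\<close>

lemma orthogonal_to_test_functions_imp_AE_0:
  assumes h: "integrable unit_measure h"
    and 0: "\<And>\<psi>. test_function \<psi> \<Longrightarrow> inner_L2 h \<psi> = 0"
  shows "AE x in unit_measure. h x = 0"
proof -
  let ?g = "\<lambda>x. indicator {0<..<1} x *\<^sub>R h x"
  have "AE x in lebesgue. ?g x = 0"
  proof (rule zero_AE_if_interval_integrals_zero)
    show "integrable lebesgue ?g"
      using h by (subst (asm) integrable_restrict_space) auto
    show "(LINT x:{a..b}|lebesgue. ?g x) = 0" for a b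
    proof -
      have "(LINT x:{a..b}|lebesgue. ?g x) = (LINT x|lebesgue. indicator {0<..<1} x *\<^sub>R (h x * indicator {a..b} x))"
        unfolding set_lebesgue_integral_def by (simp add: mult_ac)
      also have "\<dots> = (LINT x|unit_measure. h x * indicator {a..b} x)"
        by (rule integral_restrict_space[symmetric]) simp
      finally show ?thesis using interval_integral_eq_0[OF h 0] by simp
    qed
    show "(LINT x|lebesgue. ?g x) = 0"
    proof -
      have "(LINT x|unit_measure. h x * 1) = 0"
        by (rule integral_times_smooth_eq_0[OF h 0 smooth_const])
      then show ?thesis by (subst (asm) integral_restrict_space) auto
    qed
  qed
  then show ?thesis
    unfolding unit_AE_iff by eventually_elim (simp add: indicator_def)
qed

lemma weak_deriv_unique:
  assumes "g \<in> L2" "g' \<in> L2" "has_weak_deriv m f g" "has_weak_deriv m f g'"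
  shows "AE x in unit_measure. g x = g' x"
proof -
  have i: "integrable unit_measure g" "integrable unit_measure g'" using assms L2_integrable by auto
  have "AE x in unit_measure. g x - g' x = 0"
  proof (rule orthogonal_to_test_functions_imp_AE_0)
    show "integrable unit_measure (\<lambda>x. g x - g' x)" using i by simp
    fix \<psi> assume t: "test_function \<psi>"
    then have "(-1) ^ m * inner_L2 g \<psi> = (-1) ^ m * inner_L2 g' \<psi>"
      using assms(3,4) by (simp add: has_weak_deriv_def)
    then have "inner_L2 g \<psi> = inner_L2 g' \<psi>" by simp
    moreover have "smooth \<psi>" using t by (simp add: test_function_iff)
    ultimately show "inner_L2 (\<lambda>x. g x - g' x) \<psi> = 0"
      using integrable_times_smooth[OF i(1)] integrable_times_smooth[OF i(2)]
      by (simp add: inner_L2_def left_diff_distrib)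
  qed
  then show ?thesis by eventually_elim simp
qed

text \<open>Almost everywhere equality to a smooth function is the right hypothesis,
  because \<open>weak_deriv\<close> picks an arbitrary representative and \<open>A\<close> is applied repeatedly.\<close>

lemma has_weak_deriv_AE_smooth:
  assumes "f \<in> borel_measurable unit_measure" "AE x in unit_measure. f x = p x" "smooth p"
  shows "has_weak_deriv m f ((deriv ^^ m) p)"
  unfolding has_weak_deriv_def
proof (intro allI impI)
  fix \<psi> assume t: "test_function \<psi>"
  have "smooth ((deriv ^^ m) \<psi>)" using t by (simp add: test_function_iff smooth_deriv_iterate)
  then have "inner_L2 f ((deriv ^^ m) \<psi>) = inner_L2 p ((deriv ^^ m) \<psi>)"
    using assms by (intro inner_L2_AE_cong) (auto intro: smooth_measurable)
  then show "inner_L2 f ((deriv ^^ m) \<psi>) = (-1) ^ m * inner_L2 ((deriv ^^ m) p) \<psi>"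
    using smooth_has_weak_deriv[OF assms(3), of m] t by (simp add: has_weak_deriv_def)
qed

lemma weak_deriv_AE_smooth:
  assumes "f \<in> borel_measurable unit_measure" "AE x in unit_measure. f x = p x" "smooth p"
  shows "weak_deriv m f \<in> L2"
    and "AE x in unit_measure. weak_deriv m f x = (deriv ^^ m) p x"
proof -
  have p: "(deriv ^^ m) p \<in> L2" using assms by (intro smooth_L2 smooth_deriv_iterate)
  have "weak_deriv m f \<in> L2 \<and> has_weak_deriv m f (weak_deriv m f)"
    unfolding weak_deriv_def
    by (rule someI[where x = "(deriv ^^ m) p"]) (use p has_weak_deriv_AE_smooth[OF assms] in auto)
  with p has_weak_deriv_AE_smooth[OF assms] show "weak_deriv m f \<in> L2"
    "AE x in unit_measure. weak_deriv m f x = (deriv ^^ m) p x"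
    by (auto intro: weak_deriv_unique)
qed

lemma AE_smooth_in_H:
  assumes "f \<in> borel_measurable unit_measure" "AE x in unit_measure. f x = p x" "smooth p"
  shows "f \<in> H m"
  using L2_AE_cong[OF smooth_L2[OF assms(3)] assms(2,1)] has_weak_deriv_AE_smooth[OF assms]
    smooth_L2[OF smooth_deriv_iterate[OF assms(3)]]
  by (auto simp: H_def)

section \<open>Approximation by test functions in the Sobolev norm\<close>

lemma DERIV_cutoff:
  "(cutoff n has_real_derivative
      real n * flat_exp 2 (real n * x - 1) * flat_exp 0 (real n * (1 - x) - 1)
      - real n * flat_exp 0 (real n * x - 1) * flat_exp 2 (real n * (1 - x) - 1)) (at x)"
proof -
  have d: "(flat_exp 0 has_real_derivative flat_exp 2 t) (at t)" for t
    using DERIV_flat_exp[of 0 t] by (simp add: numeral_2_eq_2)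
  have "((\<lambda>x. flat_exp 0 (real n * x - 1)) has_real_derivative
      flat_exp 2 (real n * x - 1) * real n) (at x)"
    by (rule DERIV_chain2[OF d]) (auto intro!: derivative_eq_intros)
  moreover have "((\<lambda>x. flat_exp 0 (real n * (1 - x) - 1)) has_real_derivative
      flat_exp 2 (real n * (1 - x) - 1) * (- real n)) (at x)"
    by (rule DERIV_chain2[OF d]) (auto intro!: derivative_eq_intros)
  ultimately show ?thesis
    unfolding cutoff_def[abs_def] by (auto intro!: derivative_eq_intros)
qed

text \<open>The slope of the cutoff is of order $n$ near the end points, where a smooth function vanishing there
  is of order $x$. Their product is governed by $s = n x$ through the expression below, which is
  bounded and tends to $0$ as $s \to \infty$; this is exactly what dominated convergence requires.
  The bound holds because $e^v \ge 1 + v + v^2/2$ for $v = 1/(s-1)$.\<close>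

lemma scaled_slope_le: "s * flat_exp 2 (s - 1) \<le> 3"
proof (cases "s > 1")
  case True
  define t where "t = s - 1"
  have t: "t > 0" using True by (simp add: t_def)
  have e: "exp (1 / t) \<ge> 1 + 1 / t + (1 / t)\<^sup>2 / 2"
    using exp_lower_Taylor_quadratic[of "1 / t"] t by simp
  have "s * flat_exp 2 (s - 1) = (1 / t + (1 / t)\<^sup>2) / exp (1 / t)"
  proof -
    have "s = t + 1" by (simp add: t_def)
    then show ?thesis
      using t by (simp add: flat_exp_def exp_minus field_simps power2_eq_square)
  qed
  also have "\<dots> \<le> 3"
  proof -
    have "1 / t \<ge> 0" "(1 / t)\<^sup>2 \<ge> 0" using t by auto
    with e have "1 / t + (1 / t)\<^sup>2 \<le> 3 * exp (1 / t)" by linarith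
    then show ?thesis by (simp add: pos_divide_le_eq)
  qed
  finally show ?thesis .
qed (auto simp: flat_exp_def)

lemma scaled_slope_nonneg: "0 \<le> s * flat_exp 2 (s - 1)"
  by (auto simp: flat_exp_def)

lemma scaled_slope_tendsto_0: "((\<lambda>s. s * flat_exp 2 (s - 1)) \<longlongrightarrow> 0) at_top"
proof (rule tendsto_sandwich[OF _ _ tendsto_const])
  show "\<forall>\<^sub>F s in at_top. s * flat_exp 2 (s - 1) \<le> 1 / (s - 1) + 1 / (s - 1) * (1 / (s - 1))"
    using eventually_gt_at_top[of 1]
  proof eventually_elim
    case (elim s)
    have "s * flat_exp 2 (s - 1) = exp (- (1 / (s - 1))) * (s / (s - 1)\<^sup>2)"
      using elim by (simp add: flat_exp_def)
    also have "\<dots> \<le> 1 * (s / (s - 1)\<^sup>2)"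
      using elim by (intro mult_right_mono) auto
    also have "\<dots> = 1 / (s - 1) + 1 / (s - 1) * (1 / (s - 1))"
      using elim by (simp add: divide_simps power2_eq_square)
    finally show ?case .
  qed
  have "filterlim (\<lambda>s::real. - 1 + s) at_top at_top"
    by (rule filterlim_tendsto_add_at_top[OF tendsto_const filterlim_ident])
  then have "((\<lambda>s::real. 1 / (s - 1)) \<longlongrightarrow> 0) at_top"
    by (intro tendsto_divide_0[OF tendsto_const] filterlim_at_top_imp_at_infinity) simp
  from tendsto_add[OF this tendsto_mult[OF this this]]
  show "((\<lambda>s::real. 1 / (s - 1) + 1 / (s - 1) * (1 / (s - 1))) \<longlongrightarrow> 0) at_top" by simp
qed (auto intro!: always_eventually scaled_slope_nonneg)

lemma smooth_vanishing_linear_bound: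
  assumes p: "smooth p" and p0: "p 0 = 0" and p1: "p 1 = 0"
  shows "\<exists>C\<ge>0. \<forall>x\<in>{0..1}. \<bar>p x\<bar> \<le> C * x \<and> \<bar>p x\<bar> \<le> C * (1 - x)"
proof -
  obtain C where C: "\<And>x. x \<in> {0..1} \<Longrightarrow> \<bar>deriv p x\<bar> \<le> C"
    using smooth_bounded[OF smooth_deriv[OF p]] by blast
  have bd: "\<bar>p x - p y\<bar> \<le> C * \<bar>x - y\<bar>" if "x \<in> {0..1}" "y \<in> {0..1}" for x y
    using field_differentiable_bound[of "{0..1}" p "deriv p" C y x] C that
      smooth_DERIV[OF p, THEN has_field_derivative_at_within]
    by (simp add: abs_minus_commute)
  have "C \<ge> 0" using C[of 0] by simp
  moreover have "\<bar>p x\<bar> \<le> C * x \<and> \<bar>p x\<bar> \<le> C * (1 - x)" if "x \<in> {0..1}" for x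
    using bd[of x 0] bd[of x 1] that p0 p1 by auto
  ultimately show ?thesis by blast
qed

text \<open>Dominated convergence. In the derivative of the error the critical term is \<open>p\<close> times the slope of the
  cutoff; the vanishing of \<open>p\<close> at $0$ and $1$ keeps it bounded, although the slope is not.\<close>

lemma cutoff_error_tendsto_0:
  assumes p: "smooth p" and p0: "p 0 = 0" and p1: "p 1 = 0"
  shows "(\<lambda>n. LINT x|unit_measure. (p x - p x * cutoff n x)\<^sup>2) \<longlonglongrightarrow> 0"
    and "(\<lambda>n. LINT x|unit_measure. (deriv (\<lambda>x. p x - p x * cutoff n x) x)\<^sup>2) \<longlonglongrightarrow> 0"
proof -
  have sm: "smooth (\<lambda>x. p x - p x * cutoff n x)" for n
    by (intro smooth_diff smooth_mult smooth_cutoff p)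
  obtain B where B: "\<And>x. x \<in> {0..1} \<Longrightarrow> \<bar>p x\<bar> \<le> B" using smooth_bounded[OF p] by blast
  obtain B' where B': "\<And>x. x \<in> {0..1} \<Longrightarrow> \<bar>deriv p x\<bar> \<le> B'"
    using smooth_bounded[OF smooth_deriv[OF p]] by blast
  obtain C where C: "C \<ge> 0" "\<And>x. x \<in> {0..1} \<Longrightarrow> \<bar>p x\<bar> \<le> C * x"
      "\<And>x. x \<in> {0..1} \<Longrightarrow> \<bar>p x\<bar> \<le> C * (1 - x)"
    using smooth_vanishing_linear_bound[OF p p0 p1] by blast
  define g where "g s = s * flat_exp 2 (s - 1)" for s
  define c' where "c' n x = real n * flat_exp 2 (real n * x - 1) * flat_exp 0 (real n * (1 - x) - 1)
      - real n * flat_exp 0 (real n * x - 1) * flat_exp 2 (real n * (1 - x) - 1)" for n x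
  have dd: "deriv (\<lambda>x. p x - p x * cutoff n x) x = deriv p x * (1 - cutoff n x) - p x * c' n x" for n x
  proof (rule DERIV_imp_deriv)
    show "((\<lambda>x. p x - p x * cutoff n x) has_real_derivative
        deriv p x * (1 - cutoff n x) - p x * c' n x) (at x)"
      unfolding c'_def
      by (rule derivative_eq_intros smooth_DERIV[OF p] DERIV_cutoff refl | simp add: algebra_simps)+
  qed
  have pc: "\<bar>p x * c' n x\<bar> \<le> C * (g (real n * x) + g (real n * (1 - x)))" if x: "0 < x" "x < 1" for n x
  proof -
    have f2: "flat_exp 2 t \<ge> 0" for t by (simp add: flat_exp_def)
    let ?a = "real n * flat_exp 2 (real n * x - 1)"
    let ?b = "real n * flat_exp 2 (real n * (1 - x) - 1)"
    have "\<bar>c' n x\<bar> \<le> ?a * flat_exp 0 (real n * (1 - x) - 1) + ?b * flat_exp 0 (real n * x - 1)"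
      unfolding c'_def using f2 flat_exp_0_bounds(1)
      by (intro order_trans[OF abs_triangle_ineq4]) (simp add: abs_mult mult_ac)
    also have "\<dots> \<le> ?a * 1 + ?b * 1"
      using f2 flat_exp_0_bounds by (intro add_mono mult_left_mono) auto
    finally have "\<bar>p x\<bar> * \<bar>c' n x\<bar> \<le> \<bar>p x\<bar> * (?a + ?b)" by (intro mult_left_mono) auto
    also have "\<dots> = \<bar>p x\<bar> * ?a + \<bar>p x\<bar> * ?b" by (simp add: algebra_simps)
    also have "\<dots> \<le> (C * x) * ?a + (C * (1 - x)) * ?b"
      using x C(2,3)[of x] f2 by (intro add_mono mult_right_mono) auto
    finally show ?thesis by (simp add: abs_mult g_def algebra_simps)
  qed
  have g3: "g s \<le> 3" "0 \<le> g s" for s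
    using scaled_slope_le scaled_slope_nonneg by (auto simp: g_def)
  have lim: "filterlim (\<lambda>n. real n * y) at_top sequentially" if "y > 0" for y
    using filterlim_at_top_mult_tendsto_pos[OF tendsto_const that filterlim_real_sequentially] .
  have cut: "\<bar>1 - cutoff n x\<bar> \<le> 1" for n x using cutoff_bounds[of n x] by auto

  show "(\<lambda>n. LINT x|unit_measure. (p x - p x * cutoff n x)\<^sup>2) \<longlonglongrightarrow> 0"
  proof -
    have "(\<lambda>n. LINT x|unit_measure. (p x - p x * cutoff n x)\<^sup>2) \<longlonglongrightarrow> (LINT x|unit_measure. 0)"
    proof (rule integral_dominated_convergence[where w = "\<lambda>x. B\<^sup>2"])
      show "AE x in unit_measure. (\<lambda>n. (p x - p x * cutoff n x)\<^sup>2) \<longlonglongrightarrow> 0"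
      proof (rule unit_AE_I)
        fix x :: real assume "0 < x" "x < 1"
        then have "(\<lambda>n. (p x - p x * cutoff n x)\<^sup>2) \<longlonglongrightarrow> (p x - p x * 1)\<^sup>2"
          by (intro tendsto_intros cutoff_tendsto)
        then show "(\<lambda>n. (p x - p x * cutoff n x)\<^sup>2) \<longlonglongrightarrow> 0" by simp
      qed
      show "AE x in unit_measure. norm ((p x - p x * cutoff n x)\<^sup>2) \<le> B\<^sup>2" for n
      proof (rule unit_AE_I)
        fix x :: real assume x: "0 < x" "x < 1"
        have "\<bar>p x - p x * cutoff n x\<bar> = \<bar>p x\<bar> * \<bar>1 - cutoff n x\<bar>"
          by (simp add: abs_mult[symmetric] algebra_simps)
        also have "\<dots> \<le> B * 1" using B[of x] x cut by (intro mult_mono) auto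
        finally show "norm ((p x - p x * cutoff n x)\<^sup>2) \<le> B\<^sup>2"
          by (simp add: power2_le_iff_abs_le)
      qed
      show "(\<lambda>x. (p x - p x * cutoff n x)\<^sup>2) \<in> borel_measurable unit_measure" for n
        by (intro borel_measurable_power smooth_measurable sm)
    qed (use finite_measure.integrable_const[OF finite_unit_measure] in auto)
    then show ?thesis by simp
  qed

  show "(\<lambda>n. LINT x|unit_measure. (deriv (\<lambda>x. p x - p x * cutoff n x) x)\<^sup>2) \<longlonglongrightarrow> 0"
  proof -
    have "(\<lambda>n. LINT x|unit_measure. (deriv (\<lambda>x. p x - p x * cutoff n x) x)\<^sup>2) \<longlonglongrightarrow> (LINT x|unit_measure. 0)"
    proof (rule integral_dominated_convergence[where w = "\<lambda>x. (B' + C * 6)\<^sup>2"])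
      show "AE x in unit_measure. (\<lambda>n. (deriv (\<lambda>x. p x - p x * cutoff n x) x)\<^sup>2) \<longlonglongrightarrow> 0"
      proof (rule unit_AE_I)
        fix x :: real assume x: "0 < x" "x < 1"
        have g0: "(\<lambda>n. g (real n * y)) \<longlonglongrightarrow> 0" if "y > 0" for y
          unfolding g_def by (rule filterlim_compose[OF scaled_slope_tendsto_0 lim[OF that]])
        have "(\<lambda>n. C * (g (real n * x) + g (real n * (1 - x)))) \<longlonglongrightarrow> C * (0 + 0)"
          using x by (intro tendsto_intros g0) auto
        then have "(\<lambda>n. C * (g (real n * x) + g (real n * (1 - x)))) \<longlonglongrightarrow> 0" by simp
        then have "(\<lambda>n. p x * c' n x) \<longlonglongrightarrow> 0"
          by (rule Lim_null_comparison[rotated])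
             (intro always_eventually allI, simp only: real_norm_def pc[OF x])
        moreover have "(\<lambda>n. deriv p x * (1 - cutoff n x)) \<longlonglongrightarrow> deriv p x * (1 - 1)"
          using x by (intro tendsto_intros cutoff_tendsto)
        ultimately have "(\<lambda>n. (deriv p x * (1 - cutoff n x) - p x * c' n x)\<^sup>2) \<longlonglongrightarrow> (deriv p x * (1 - 1) - 0)\<^sup>2"
          by (intro tendsto_power tendsto_diff)
        then show "(\<lambda>n. (deriv (\<lambda>x. p x - p x * cutoff n x) x)\<^sup>2) \<longlonglongrightarrow> 0"
          by (simp add: dd)
      qed
      show "AE x in unit_measure. norm ((deriv (\<lambda>x. p x - p x * cutoff n x) x)\<^sup>2) \<le> (B' + C * 6)\<^sup>2" for n
      proof (rule unit_AE_I)
        fix x :: real assume x: "0 < x" "x < 1"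
        have "\<bar>deriv p x\<bar> * \<bar>1 - cutoff n x\<bar> \<le> B' * 1"
          using B'[of x] x cut by (intro mult_mono) auto
        moreover have "\<bar>p x * c' n x\<bar> \<le> C * 6"
        proof -
          have "C * (g (real n * x) + g (real n * (1 - x))) \<le> C * (3 + 3)"
            using C(1) g3 by (intro mult_left_mono add_mono) auto
          with pc[OF x, of n] show ?thesis by simp
        qed
        ultimately have "\<bar>deriv p x * (1 - cutoff n x) - p x * c' n x\<bar> \<le> B' + C * 6"
          by (intro order_trans[OF abs_triangle_ineq4]) (simp add: abs_mult)
        from power_mono[OF this, of 2]
        show "norm ((deriv (\<lambda>x. p x - p x * cutoff n x) x)\<^sup>2) \<le> (B' + C * 6)\<^sup>2"
          by (simp add: dd)
      qed
      show "(\<lambda>x. (deriv (\<lambda>x. p x - p x * cutoff n x) x)\<^sup>2) \<in> borel_measurable unit_measure" for n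
        by (intro borel_measurable_power smooth_measurable smooth_deriv sm)
    qed (use finite_measure.integrable_const[OF finite_unit_measure] in auto)
    then show ?thesis by simp
  qed
qed

lemma inner_L2_self_AE_smooth:
  assumes "AE x in unit_measure. f x = p x" "f \<in> borel_measurable unit_measure" "smooth p"
  shows "inner_L2 f f = (LINT x|unit_measure. (p x)\<^sup>2)"
  unfolding inner_L2_def
proof (rule integral_cong_AE)
  show "AE x in unit_measure. f x * f x = (p x)\<^sup>2"
    using assms(1) by eventually_elim (simp add: power2_eq_square)
qed (use assms smooth_measurable in \<open>auto intro: borel_measurable_times borel_measurable_power\<close>)

lemma AE_smooth_vanishing_in_H10:
  assumes f: "f \<in> borel_measurable unit_measure" "AE x in unit_measure. f x = p x"
    and p: "smooth p" "p 0 = 0" "p 1 = 0"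
  shows "f \<in> H10"
proof -
  let ?e = "\<lambda>n x. p x - p x * cutoff n x"
  have norm: "H1_norm (\<lambda>x. f x - p x * cutoff n x) =
      sqrt ((LINT x|unit_measure. (?e n x)\<^sup>2) + (LINT x|unit_measure. (deriv (?e n) x)\<^sup>2))" for n
  proof -
    have e: "smooth (?e n)" by (intro smooth_diff smooth_mult smooth_cutoff p)
    have m: "(\<lambda>x. f x - p x * cutoff n x) \<in> borel_measurable unit_measure"
      by (intro borel_measurable_diff f(1) smooth_measurable smooth_mult p(1) smooth_cutoff)
    have ae: "AE x in unit_measure. f x - p x * cutoff n x = ?e n x"
      using f(2) by eventually_elim simp
    note w = weak_deriv_AE_smooth[OF m ae e, of 1]
    have wm: "weak_deriv 1 (\<lambda>x. f x - p x * cutoff n x) \<in> borel_measurable unit_measure"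
      using w(1) by (simp add: L2_def)
    have wae: "AE x in unit_measure. weak_deriv 1 (\<lambda>x. f x - p x * cutoff n x) x = deriv (?e n) x"
      using w(2) by simp
    show ?thesis
      unfolding H1_norm_def inner_L2_self_AE_smooth[OF ae m e]
        inner_L2_self_AE_smooth[OF wae wm smooth_deriv[OF e]] ..
  qed
  have "(\<lambda>n. H1_norm (\<lambda>x. f x - p x * cutoff n x)) \<longlonglongrightarrow> sqrt (0 + 0)"
    unfolding norm by (intro tendsto_intros cutoff_error_tendsto_0 p)
  then have lim: "(\<lambda>n. H1_norm (\<lambda>x. f x - p x * cutoff n x)) \<longlonglongrightarrow> 0" by simp
  have "\<exists>\<psi>. test_function \<psi> \<and> H1_norm (\<lambda>x. f x - \<psi> x) < \<epsilon>" if "\<epsilon> > 0" for \<epsilon>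
  proof -
    obtain n where "H1_norm (\<lambda>x. f x - p x * cutoff n x) < \<epsilon>"
      using eventually_happens'[OF sequentially_bot order_tendstoD(2)[OF lim \<open>\<epsilon> > 0\<close>]] by blast
    with test_function_cutoff[OF p(1)] show ?thesis by (intro exI[of _ "\<lambda>x. p x * cutoff n x"]) auto
  qed
  with AE_smooth_in_H[OF f p(1)] show ?thesis by (auto simp: H10_def)
qed

section \<open>Finite sums of eigenfunctions\<close>

definition sine_sum :: "nat set \<Rightarrow> (nat \<Rightarrow> nat) \<Rightarrow> (nat \<Rightarrow> real) \<Rightarrow> real \<Rightarrow> real"
  where "sine_sum I w c x = (\<Sum>u\<in>I. c u * ef (w u) x)"

lemma DERIV_ef: "(ef j has_real_derivative sqrt 2 * (real j * pi) * cos (real j * pi * x)) (at x)"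
  unfolding ef_def[abs_def] by (auto intro!: derivative_eq_intros)

lemma deriv_ef: "deriv (ef j) x = sqrt 2 * (real j * pi) * cos (real j * pi * x)"
  by (rule DERIV_imp_deriv[OF DERIV_ef])

lemma smooth_ef: "smooth (ef j)"
  using smooth_trig[of "sqrt 2" "real j * pi" 0] by (simp add: ef_def[abs_def])

lemma smooth_sine_sum: "smooth (sine_sum I w c)"
  unfolding sine_sum_def[abs_def] by (intro smooth_sum smooth_scale smooth_ef)

lemma sine_sum_0: "sine_sum I w c 0 = 0"
  by (simp add: sine_sum_def ef_def)

lemma sine_sum_1: "sine_sum I w c 1 = 0"
  by (simp add: sine_sum_def ef_def)

lemma deriv_deriv_sine_sum:
  "deriv (deriv (sine_sum I w c)) = sine_sum I w (\<lambda>u. - ev (w u) * c u)"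
proof -
  have "deriv (sine_sum I w c) = (\<lambda>x. \<Sum>u\<in>I. c u * (sqrt 2 * (real (w u) * pi) * cos (real (w u) * pi * x)))"
    by (rule ext, rule DERIV_imp_deriv)
       (auto simp: sine_sum_def[abs_def] mult_ac intro!: derivative_eq_intros DERIV_ef)
  moreover have "((\<lambda>x. \<Sum>u\<in>I. c u * (sqrt 2 * (real (w u) * pi) * cos (real (w u) * pi * x)))
      has_real_derivative sine_sum I w (\<lambda>u. - ev (w u) * c u) x) (at x)" for x
    unfolding sine_sum_def
    by (rule DERIV_sum) (auto intro!: derivative_eq_intros simp: ef_def ev_def power2_eq_square)
  ultimately show ?thesis by (auto simp: DERIV_imp_deriv)
qed

lemma even_deriv_sine_sum:
  "(deriv ^^ (2 * b)) (sine_sum I w c) = sine_sum I w (\<lambda>u. (- ev (w u)) ^ b * c u)"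
proof (induction b)
  case (Suc b)
  have "(deriv ^^ (2 * Suc b)) (sine_sum I w c) = deriv (deriv ((deriv ^^ (2 * b)) (sine_sum I w c)))"
    by simp
  also have "\<dots> = sine_sum I w (\<lambda>u. (- ev (w u)) ^ Suc b * c u)"
    unfolding Suc.IH deriv_deriv_sine_sum by (simp add: mult.assoc)
  finally show ?case .
qed simp

lemma cos_integral:
  "(LINT x|unit_measure. cos (real_of_int m * pi * x)) = (if m = 0 then 1 else 0)"
proof (cases "m = 0")
  case True
  then show ?thesis using unit_integral_deriv[of "\<lambda>x. x" "\<lambda>x. 1"] by simp
next
  case False
  have "(LINT x|unit_measure. cos (real_of_int m * pi * x))
      = sin (real_of_int m * pi * 1) / (real_of_int m * pi) - sin (real_of_int m * pi * 0) / (real_of_int m * pi)"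
    by (rule unit_integral_deriv)
       (use False in \<open>auto intro!: derivative_eq_intros continuous_intros\<close>)
  also have "\<dots> = 0" using sin_int_times_real[of m pi] sin_zero_iff_int2
    by (auto simp: mult.commute)
  finally show ?thesis using False by simp
qed

lemma cos_integrable: "integrable unit_measure (\<lambda>x. cos (real_of_int m * pi * x))"
  by (intro integrable_unit_continuous continuous_intros)

lemma ef_mult_ef:
  "ef i x * ef j x = cos (real_of_int (int i - int j) * pi * x) - cos (real_of_int (int i + int j) * pi * x)"
proof -
  have "ef i x * ef j x = 2 * (sin (real i * pi * x) * sin (real j * pi * x))"
    by (simp add: ef_def)
  also have "\<dots> = cos (real i * pi * x - real j * pi * x) - cos (real i * pi * x + real j * pi * x)"
    by (simp add: cos_diff cos_add)
  finally show ?thesis by (simp add: algebra_simps)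
qed

lemma ef_orthogonal: "i \<noteq> j \<Longrightarrow> inner_L2 (ef i) (ef j) = 0"
  unfolding inner_L2_def ef_mult_ef
  by (subst Bochner_Integration.integral_diff[OF cos_integrable cos_integrable])
     (simp add: cos_integral del: of_int_diff of_int_add)

lemma triple_integral:
  "(LINT x|unit_measure. ef i x * ef j x * deriv (ef k) x) = real k * pi / sqrt 2 *
     ((if i = j + k then 1 else 0) + (if j = i + k then 1 else 0)
      - (if i + j = k then 1 else 0) - (if i + j + k = 0 then 1 else 0))"
proof -
  let ?c = "\<lambda>m x. cos (real_of_int m * pi * x)"
  have prod: "?c a x * ?c b x = (?c (a - b) x + ?c (a + b) x) / 2" for a b x
  proof -
    have "?c a x * ?c b x = (cos (real_of_int a * pi * x - real_of_int b * pi * x)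
        + cos (real_of_int a * pi * x + real_of_int b * pi * x)) / 2"
      by (simp add: cos_diff cos_add)
    then show ?thesis by (simp add: algebra_simps)
  qed
  have "ef i x * ef j x * deriv (ef k) x = real k * pi / sqrt 2 *
      ((?c (int i - int j - int k) x + ?c (int i - int j + int k) x)
       - (?c (int i + int j - int k) x + ?c (int i + int j + int k) x))" for x
  proof -
    have "ef i x * ef j x * deriv (ef k) x = sqrt 2 * (real k * pi) *
        (?c (int i - int j) x * ?c (int k) x - ?c (int i + int j) x * ?c (int k) x)"
      unfolding ef_mult_ef deriv_ef by (simp add: algebra_simps)
    also have "\<dots> = sqrt 2 / 2 * (real k * pi) *
      ((?c (int i - int j - int k) x + ?c (int i - int j + int k) x)
       - (?c (int i + int j - int k) x + ?c (int i + int j + int k) x))"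
      unfolding prod by (simp only: diff_divide_distrib[symmetric] times_divide_eq_left times_divide_eq_right)
    also have "sqrt 2 / 2 = 1 / sqrt (2 :: real)"
      by (simp add: field_simps)
    finally show ?thesis by simp
  qed
  then have "(LINT x|unit_measure. ef i x * ef j x * deriv (ef k) x)
    = real k * pi / sqrt 2 * (((if int i - int j - int k = 0 then 1 else 0) + (if int i - int j + int k = 0 then 1 else 0))
      - ((if int i + int j - int k = 0 then 1 else 0) + (if int i + int j + int k = 0 then 1 else 0)))"
    by (simp only: integral_mult_right_zero Bochner_Integration.integral_diff
        Bochner_Integration.integral_add Bochner_Integration.integrable_add cos_integrable cos_integral)
  also have "\<dots> = real k * pi / sqrt 2 *
     ((if i = j + k then 1 else 0) + (if j = i + k then 1 else 0)
      - (if i + j = k then 1 else 0) - (if i + j + k = 0 then 1 else 0))"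
  proof -
    have "int i - int j - int k = 0 \<longleftrightarrow> i = j + k" "int i - int j + int k = 0 \<longleftrightarrow> j = i + k"
      "int i + int j - int k = 0 \<longleftrightarrow> i + j = k" "int i + int j + int k = 0 \<longleftrightarrow> i + j + k = 0"
      by auto
    then show ?thesis by simp
  qed
  finally show ?thesis .
qed

lemma inner_sine_sum_ef_eq_0:
  assumes "\<And>u. u \<in> I \<Longrightarrow> w u \<noteq> j"
  shows "inner_L2 (sine_sum I w c) (ef j) = 0"
proof -
  have i: "integrable unit_measure (\<lambda>x. ef i x * ef j x)" for i
    by (intro integrable_unit_continuous smooth_continuous smooth_mult smooth_ef)
  have "inner_L2 (sine_sum I w c) (ef j) = (\<Sum>u\<in>I. c u * inner_L2 (ef (w u)) (ef j))"
    unfolding inner_L2_def sine_sum_def using i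
    by (simp add: sum_distrib_right mult.assoc Bochner_Integration.integral_sum)
  also have "\<dots> = 0" using assms by (intro sum.neutral) (auto simp: ef_orthogonal)
  finally show ?thesis .
qed

text \<open>Up to null sets, \<open>A\<close> maps a sine sum to the sine sum with coefficients multiplied by the
  eigenvalues, so the recursion defining the domains stays inside this class. Quantifying over all
  representatives of the sum makes the induction go through, as \<open>A f\<close> is known only almost everywhere.\<close>

lemma AE_sine_sum_in_dom_A_half:
  assumes "finite I" "f \<in> borel_measurable unit_measure" "AE x in unit_measure. f x = sine_sum I w c x"
  shows "f \<in> dom_A_half n"
  using assms(2,3)
proof (induction n arbitrary: f c rule: dom_A_half.induct)
  case 1
  then show ?case using L2_AE_cong[OF smooth_L2[OF smooth_sine_sum]] by simp
next
  case 2
  have "inner_L2 f (ef (Suc i)) = 0" if "i \<notin> (\<lambda>u. w u - 1) ` I" for i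
  proof -
    have "inner_L2 f (ef (Suc i)) = inner_L2 (sine_sum I w c) (ef (Suc i))"
      by (rule inner_L2_AE_cong[OF 2(2) 2(1)]) (intro smooth_measurable smooth_sine_sum smooth_ef)+
    also have "\<dots> = 0" using that by (intro inner_sine_sum_ef_eq_0) force
    finally show ?thesis .
  qed
  then have "summable (\<lambda>i. ev (Suc i) * (inner_L2 f (ef (Suc i)))\<^sup>2)"
    by (intro summable_finite[of "(\<lambda>u. w u - 1) ` I"]) (use assms(1) in auto)
  moreover have "f \<in> L2" using L2_AE_cong[OF smooth_L2[OF smooth_sine_sum]] 2 by blast
  ultimately show ?case by simp
next
  case (3 n)
  note w = weak_deriv_AE_smooth[OF 3(2,3) smooth_sine_sum, of 2]
  have "A f \<in> dom_A_half n"
  proof (rule 3(1))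
    have "weak_deriv 2 f \<in> borel_measurable unit_measure" using w(1) by (simp add: L2_def)
    then show "A f \<in> borel_measurable unit_measure"
      unfolding A_def by (rule borel_measurable_uminus)
    show "AE x in unit_measure. A f x = sine_sum I w (\<lambda>u. ev (w u) * c u) x"
      using w(2)
    proof eventually_elim
      case (elim x)
      then show ?case
        unfolding A_def numeral_2_eq_2 by (simp add: deriv_deriv_sine_sum sine_sum_def sum_negf)
    qed
  qed
  moreover have "f \<in> dom_A"
    unfolding dom_A_def
    using AE_smooth_in_H[OF 3(2,3) smooth_sine_sum]
      AE_smooth_vanishing_in_H10[OF 3(2,3) smooth_sine_sum sine_sum_0 sine_sum_1] by blast
  ultimately show ?case by simp
qed

lemma sine_sum_in_dom_A_inf: "finite I \<Longrightarrow> sine_sum I w c \<in> dom_A_inf"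
  unfolding dom_A_inf_def
  by (intro INT_I AE_sine_sum_in_dom_A_half[where c = c and w = w and I = I] smooth_measurable smooth_sine_sum AE_I2 refl)

lemma weak_deriv_sine_sum_AE:
  "weak_deriv (2 * b) (sine_sum I w c) \<in> borel_measurable unit_measure"
  "AE x in unit_measure. weak_deriv (2 * b) (sine_sum I w c) x = sine_sum I w (\<lambda>u. (- ev (w u)) ^ b * c u) x"
proof -
  note w = weak_deriv_AE_smooth[OF smooth_measurable[OF smooth_sine_sum] _ smooth_sine_sum, of I w c I w c "2 * b", OF AE_I2[OF refl]]
  show "weak_deriv (2 * b) (sine_sum I w c) \<in> borel_measurable unit_measure"
    using w(1) by (simp add: L2_def)
  show "AE x in unit_measure. weak_deriv (2 * b) (sine_sum I w c) x = sine_sum I w (\<lambda>u. (- ev (w u)) ^ b * c u) x"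
    using w(2) unfolding even_deriv_sine_sum .
qed

lemma inner_sine_sum_product:
  "inner_L2 (\<lambda>x. sine_sum I w a x * sine_sum I w b x) (deriv (ef k)) =
    (\<Sum>u\<in>I. \<Sum>v\<in>I. a u * b v * (LINT x|unit_measure. ef (w u) x * ef (w v) x * deriv (ef k) x))"
proof -
  have i: "integrable unit_measure (\<lambda>x. a u * b v * (ef i x * ef j x * deriv (ef k) x))" for u v i j
    by (intro integrable_unit_continuous smooth_continuous smooth_mult smooth_ef smooth_deriv smooth_const)
  have "inner_L2 (\<lambda>x. sine_sum I w a x * sine_sum I w b x) (deriv (ef k))
    = (LINT x|unit_measure. (\<Sum>u\<in>I. \<Sum>v\<in>I. a u * b v * (ef (w u) x * ef (w v) x * deriv (ef k) x)))"
    unfolding inner_L2_def sine_sum_def sum_product unfolding sum_distrib_right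
    by (intro Bochner_Integration.integral_cong sum.cong refl) (simp only: mult_ac)
  also have "\<dots> = (\<Sum>u\<in>I. \<Sum>v\<in>I. LINT x|unit_measure. a u * b v * (ef (w u) x * ef (w v) x * deriv (ef k) x))"
    using i by (simp only: Bochner_Integration.integral_sum Bochner_Integration.integrable_sum)
  finally show ?thesis by simp
qed

text \<open>With the frequencies \<open>k * (u + 2)\<close> the triple integrals select \<open>u = Suc v\<close> and \<open>v = Suc u\<close>. The offset
  $2$ makes the sum of two frequencies at least $4k$, which excludes the remaining resonance
  $i + j = k$ of \<open>triple_integral\<close>.\<close>

lemma inner_product_multiples:
  assumes "k \<ge> 1"
  shows "inner_L2 (\<lambda>x. sine_sum {..Suc d} (\<lambda>u. k * (u + 2)) a x * sine_sum {..Suc d} (\<lambda>u. k * (u + 2)) b x)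
      (deriv (ef k)) = real k * pi / sqrt 2 * (\<Sum>u\<le>d. a u * b (Suc u) + a (Suc u) * b u)"
proof -
  let ?K = "real k * pi / sqrt 2"
  have T: "(LINT x|unit_measure. ef (k * (u + 2)) x * ef (k * (v + 2)) x * deriv (ef k) x)
    = ?K * ((if u = Suc v then 1 else 0) + (if v = Suc u then 1 else 0))" for u v
  proof -
    have "k * (u + 2) = k * (v + 2) + k \<longleftrightarrow> u = Suc v" for u v
    proof -
      have "k * (v + 2) + k = k * (Suc v + 2)" by simp
      then show ?thesis using assms by (metis add_right_cancel mult_cancel1 not_one_le_zero)
    qed
    moreover have "k * (u + 2) + k * (v + 2) \<noteq> k" "k * (u + 2) + k * (v + 2) + k \<noteq> 0"
      using assms by auto
    ultimately show ?thesis unfolding triple_integral by simp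
  qed
  have up: "(\<Sum>u\<le>Suc d. \<Sum>v\<le>Suc d. (if v = Suc u then a u * b v else 0)) = (\<Sum>u\<le>d. a u * b (Suc u))" for a b :: "nat \<Rightarrow> real"
  proof -
    have "(\<Sum>u\<le>Suc d. \<Sum>v\<le>Suc d. (if v = Suc u then a u * b v else 0))
      = (\<Sum>u\<le>Suc d. if Suc u \<le> Suc d then a u * b (Suc u) else 0)"
      by (intro sum.cong refl) (simp add: sum.delta)
    also have "\<dots> = (\<Sum>u\<le>d. a u * b (Suc u))" by simp
    finally show ?thesis .
  qed
  have "(\<Sum>u\<le>Suc d. \<Sum>v\<le>Suc d. a u * b v * (?K * ((if u = Suc v then 1 else 0) + (if v = Suc u then 1 else 0))))
    = ?K * ((\<Sum>u\<le>Suc d. \<Sum>v\<le>Suc d. (if u = Suc v then a u * b v else 0))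
      + (\<Sum>u\<le>Suc d. \<Sum>v\<le>Suc d. (if v = Suc u then a u * b v else 0)))"
    unfolding sum.distrib[symmetric] sum_distrib_left
    by (intro sum.cong refl) auto
  also have "(\<Sum>u\<le>Suc d. \<Sum>v\<le>Suc d. (if u = Suc v then a u * b v else 0))
      = (\<Sum>v\<le>Suc d. \<Sum>u\<le>Suc d. (if u = Suc v then b v * a u else 0))"
    by (subst sum.swap) (simp only: mult.commute)
  finally show ?thesis
    unfolding inner_sine_sum_product T up by (simp add: sum.distrib mult.commute)
qed

section \<open>Finite differences and the polynomials of Lucas's triangle\<close>

text \<open>The \<open>d\<close>-th finite difference at $0$ of a power. Induction on \<open>d\<close>: absorbing one factor \<open>u\<close> into
  the binomial coefficient and expanding $(u+1)^j$ leaves differences of order \<open>d\<close> of lower powers.\<close>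

lemma alternating_binomial_power_sum:
  assumes "i \<le> d"
  shows "(\<Sum>u\<le>d. (- 1) ^ u * real (d choose u) * real u ^ i) = (if i = d then (- 1) ^ d * fact d else 0)"
  using assms
proof (induction d arbitrary: i)
  case 0
  then show ?case by simp
next
  case (Suc d)
  show ?case
  proof (cases i)
    case 0
    have "(\<Sum>u\<le>Suc d. (- 1) ^ u * real (Suc d choose u)) = 0"
      by (rule choose_alternating_sum) simp
    then show ?thesis using 0 by simp
  next
    case (Suc j)
    have j: "j \<le> d" using Suc Suc.prems by simp
    have "(\<Sum>u\<le>Suc d. (- 1) ^ u * real (Suc d choose u) * real u ^ i)
      = (\<Sum>u\<le>d. (- 1) ^ Suc u * real (Suc d choose Suc u) * real (Suc u) ^ Suc j)"
      unfolding Suc by (subst sum.atMost_Suc_shift) simp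
    also have "\<dots> = (\<Sum>u\<le>d. - real (Suc d) * ((- 1) ^ u * real (d choose u) * (real u + 1) ^ j))"
    proof (intro sum.cong refl)
      fix u
      have "real (Suc u) * real (Suc d choose Suc u) = real (Suc d) * real (d choose u)"
        by (metis Suc_times_binomial_eq mult.commute of_nat_mult)
      moreover have "(- 1) ^ Suc u * real (Suc d choose Suc u) * real (Suc u) ^ Suc j
        = - ((- 1) ^ u * (real (Suc u) * real (Suc d choose Suc u)) * (real u + 1) ^ j)"
        by (simp add: algebra_simps)
      ultimately show "(- 1) ^ Suc u * real (Suc d choose Suc u) * real (Suc u) ^ Suc j
        = - real (Suc d) * ((- 1) ^ u * real (d choose u) * (real u + 1) ^ j)"
        by (simp only: mult_minus_left mult_minus_right mult_ac)
    qed
    also have "\<dots> = - real (Suc d) * (\<Sum>u\<le>d. \<Sum>l\<le>j. real (j choose l) * ((- 1) ^ u * real (d choose u) * real u ^ l))"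
      by (simp add: sum_distrib_left binomial_ring mult_ac)
    also have "\<dots> = - real (Suc d) * (\<Sum>l\<le>j. real (j choose l) * (\<Sum>u\<le>d. (- 1) ^ u * real (d choose u) * real u ^ l))"
      by (subst sum.swap) (simp only: sum_distrib_left)
    also have "\<dots> = - real (Suc d) * (\<Sum>l\<le>j. real (j choose l) * (if l = d then (- 1) ^ d * fact d else 0))"
      using Suc.IH j by simp
    also have "(\<Sum>l\<le>j. real (j choose l) * (if l = d then (- 1) ^ d * fact d else 0))
        = (\<Sum>l\<le>j. if l = d then real (j choose l) * ((- 1) ^ d * fact d) else 0)"
      by (intro sum.cong) auto
    also have "\<dots> = (if j = d then (- 1) ^ d * fact d else 0)"
      using j by (simp add: sum.delta')
    also have "- real (Suc d) * (if j = d then (- 1) ^ d * fact d else 0)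
        = (if i = Suc d then (- 1) ^ Suc d * fact (Suc d) else 0)"
      by (simp add: Suc algebra_simps)
    finally show ?thesis .
  qed
qed

lemma alternating_binomial_poly_sum:
  fixes p :: "real poly"
  assumes "degree p \<le> d"
  shows "(\<Sum>u\<le>d. (- 1) ^ u * real (d choose u) * poly p (real u)) = (- 1) ^ d * fact d * coeff p d"
proof -
  have "poly p x = (\<Sum>i\<le>d. coeff p i * x ^ i)" for x
    unfolding poly_altdef
    by (rule sum.mono_neutral_left) (use assms in \<open>auto simp: coeff_eq_0\<close>)
  then have "(\<Sum>u\<le>d. (- 1) ^ u * real (d choose u) * poly p (real u))
    = (\<Sum>u\<le>d. \<Sum>i\<le>d. coeff p i * ((- 1) ^ u * real (d choose u) * real u ^ i))"
    by (simp add: sum_distrib_left mult_ac)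
  also have "\<dots> = (\<Sum>i\<le>d. coeff p i * (\<Sum>u\<le>d. (- 1) ^ u * real (d choose u) * real u ^ i))"
    by (subst sum.swap) (simp only: sum_distrib_left)
  also have "\<dots> = (\<Sum>i\<le>d. if i = d then coeff p d * ((- 1) ^ d * fact d) else 0)"
    by (intro sum.cong refl) (simp add: alternating_binomial_power_sum)
  finally show ?thesis by simp
qed

text \<open>The product of the powers $(u+2)^a (u+3)^b$ contributed by two neighbouring frequencies, symmetrised
  because both orders of the pair occur in the quadratic form.\<close>

definition pair_poly :: "nat \<Rightarrow> nat \<Rightarrow> real poly"
  where "pair_poly a b = [:2, 1:] ^ a * [:3, 1:] ^ b + [:3, 1:] ^ a * [:2, 1:] ^ b"

lemma degree_pair_poly: "degree (pair_poly a b) \<le> a + b"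
  unfolding pair_poly_def
  by (intro degree_add_le) (auto simp: degree_mult_eq degree_power_eq)

lemma coeff_pair_poly: "coeff (pair_poly a b) (a + b) = 2"
proof -
  have "coeff ([:x, 1:] ^ a * [:y, 1:] ^ b) (a + b) = 1" for x y :: real
  proof -
    have "lead_coeff ([:x, 1:] ^ a * [:y, 1:] ^ b) = 1"
      by (simp add: lead_coeff_mult lead_coeff_power)
    moreover have "degree ([:x, 1:] ^ a * [:y, 1:] ^ b) = a + b"
      by (simp add: degree_mult_eq degree_power_eq)
    ultimately show ?thesis by simp
  qed
  then show ?thesis by (simp add: pair_poly_def)
qed

definition lucas_poly :: "nat \<Rightarrow> real poly"
  where "lucas_poly m = (\<Sum>\<alpha> = 0..m. \<Sum>\<beta> = 0..m - \<alpha>.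
    smult ((- 1) ^ \<alpha> * real (lucas (m - \<beta>) \<alpha>)) (pair_poly (2 * \<beta>) (2 * (m + \<alpha>))))"

lemma degree_lucas_poly: "degree (lucas_poly m) \<le> 4 * m"
  unfolding lucas_poly_def
  by (intro degree_sum_le finite_atLeastAtMost order_trans[OF degree_smult_le]
      order_trans[OF degree_pair_poly]) auto

text \<open>The diagonal of Lucas's triangle is $1, 2, 2, 2, \dots$, so these sums alternate between $1$ and $-1$.\<close>

lemma alternating_lucas_diagonal_sum: "(\<Sum>\<alpha> = 0..m. (- 1) ^ \<alpha> * real (lucas \<alpha> \<alpha>)) = (- 1) ^ m"
  by (induction m) (auto simp: lucas_def)

text \<open>The term with indices $\alpha, \beta$ has degree $2(m + \alpha + \beta)$, so only $\beta = m - \alpha$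
  reaches degree $4m$; there the Lucas coefficient is a diagonal one.\<close>

lemma coeff_lucas_poly: "coeff (lucas_poly m) (4 * m) = 2 * (- 1) ^ m"
proof -
  have "coeff (pair_poly (2 * \<beta>) (2 * (m + \<alpha>))) (4 * m) = (if \<beta> = m - \<alpha> then 2 else 0)"
    if "\<alpha> \<in> {0..m}" "\<beta> \<in> {0..m - \<alpha>}" for \<alpha> \<beta>
  proof (cases "\<beta> = m - \<alpha>")
    case True
    then have "2 * \<beta> + 2 * (m + \<alpha>) = 4 * m" using that by auto
    then show ?thesis using coeff_pair_poly[of "2 * \<beta>" "2 * (m + \<alpha>)"] True by (simp only: if_True refl)
  next
    case False
    then have "degree (pair_poly (2 * \<beta>) (2 * (m + \<alpha>))) < 4 * m"
      using that by (intro le_less_trans[OF degree_pair_poly]) auto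
    then show ?thesis using False by (simp add: coeff_eq_0)
  qed
  then have "coeff (lucas_poly m) (4 * m) = (\<Sum>\<alpha> = 0..m. \<Sum>\<beta> = 0..m - \<alpha>.
      ((- 1) ^ \<alpha> * real (lucas (m - \<beta>) \<alpha>)) * (if \<beta> = m - \<alpha> then 2 else 0))"
    unfolding lucas_poly_def coeff_sum coeff_smult by (intro sum.cong refl) simp
  also have "\<dots> = (\<Sum>\<alpha> = 0..m. \<Sum>\<beta> = 0..m - \<alpha>.
      if \<beta> = m - \<alpha> then (- 1) ^ \<alpha> * real (lucas \<alpha> \<alpha>) * 2 else 0)"
    by (intro sum.cong refl) auto
  also have "\<dots> = (\<Sum>\<alpha> = 0..m. (- 1) ^ \<alpha> * real (lucas \<alpha> \<alpha>) * 2)"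
    by (intro sum.cong refl) simp
  also have "\<dots> = 2 * (- 1) ^ m"
    unfolding sum_distrib_right[symmetric] alternating_lucas_diagonal_sum by simp
  finally show ?thesis .
qed

section \<open>The quadratic forms on sums over multiples of the base frequency\<close>

lemma ev_mult: "ev (k * j) = ev k * (real j)\<^sup>2"
  by (simp add: ev_def power_mult_distrib)

text \<open>All eigenvalues involved are \<open>ev k\<close> times squares of $u+2$ and $u+3$. Since the exponents
  $m - \alpha - \beta$, $\beta$ and $m + \alpha$ add up to $2m$, a common power of \<open>ev k\<close> factors out and
  a polynomial in \<open>u\<close> remains.\<close>

lemma a_coeff_sine_sum:
  assumes "k \<ge> 1"
  shows "a_coeff k (Suc m) (sine_sum {..Suc d} (\<lambda>u. k * (u + 2)) c) =
    real k * pi / sqrt 2 / 2 * ev k ^ (2 * m) *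
    (\<Sum>u\<le>d. c u * c (Suc u) * poly (lucas_poly m) (real u))"
proof -
  let ?w = "\<lambda>u. k * (u + 2)" and ?K = "real k * pi / sqrt 2"
  let ?\<mu> = "sine_sum {..Suc d} ?w c"
  have pair: "inner_L2 (\<lambda>x. weak_deriv (2 * \<beta>) ?\<mu> x * weak_deriv (2 * \<gamma>) ?\<mu> x) (deriv (ef k)) =
      ?K * (- ev k) ^ (\<beta> + \<gamma>) * (\<Sum>u\<le>d. c u * c (Suc u) * poly (pair_poly (2 * \<beta>) (2 * \<gamma>)) (real u))"
    for \<beta> \<gamma>
  proof -
    let ?s = "\<lambda>b. sine_sum {..Suc d} ?w (\<lambda>u. (- ev (?w u)) ^ b * c u)"
    have "AE x in unit_measure. weak_deriv (2 * \<beta>) ?\<mu> x * weak_deriv (2 * \<gamma>) ?\<mu> x = ?s \<beta> x * ?s \<gamma> x"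
      using weak_deriv_sine_sum_AE(2)[of \<beta> "{..Suc d}" ?w c] weak_deriv_sine_sum_AE(2)[of \<gamma> "{..Suc d}" ?w c]
      by eventually_elim simp
    then have "inner_L2 (\<lambda>x. weak_deriv (2 * \<beta>) ?\<mu> x * weak_deriv (2 * \<gamma>) ?\<mu> x) (deriv (ef k))
      = inner_L2 (\<lambda>x. ?s \<beta> x * ?s \<gamma> x) (deriv (ef k))"
      by (rule inner_L2_AE_cong)
         (intro borel_measurable_times weak_deriv_sine_sum_AE(1) smooth_measurable smooth_sine_sum
            smooth_deriv smooth_ef)+
    also have "\<dots> = ?K * (\<Sum>u\<le>d. (- ev (?w u)) ^ \<beta> * c u * ((- ev (?w (Suc u))) ^ \<gamma> * c (Suc u))
        + (- ev (?w (Suc u))) ^ \<beta> * c (Suc u) * ((- ev (?w u)) ^ \<gamma> * c u))"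
      by (rule inner_product_multiples[OF assms])
    also have "(\<Sum>u\<le>d. (- ev (?w u)) ^ \<beta> * c u * ((- ev (?w (Suc u))) ^ \<gamma> * c (Suc u))
        + (- ev (?w (Suc u))) ^ \<beta> * c (Suc u) * ((- ev (?w u)) ^ \<gamma> * c u))
      = (\<Sum>u\<le>d. (- ev k) ^ (\<beta> + \<gamma>) * (c u * c (Suc u) * poly (pair_poly (2 * \<beta>) (2 * \<gamma>)) (real u)))"
    proof (intro sum.cong refl)
      fix u
      have e: "(- ev (?w u)) ^ b = (- ev k) ^ b * (2 + real u) ^ (2 * b)"
        "(- ev (?w (Suc u))) ^ b = (- ev k) ^ b * (3 + real u) ^ (2 * b)" for b
        unfolding ev_mult by (simp_all add: power_mult_distrib[symmetric] power_mult add.commute)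
      show "(- ev (?w u)) ^ \<beta> * c u * ((- ev (?w (Suc u))) ^ \<gamma> * c (Suc u))
        + (- ev (?w (Suc u))) ^ \<beta> * c (Suc u) * ((- ev (?w u)) ^ \<gamma> * c u)
        = (- ev k) ^ (\<beta> + \<gamma>) * (c u * c (Suc u) * poly (pair_poly (2 * \<beta>) (2 * \<gamma>)) (real u))"
        unfolding e pair_poly_def by (simp add: power_add algebra_simps)
    qed
    finally show ?thesis by (simp only: sum_distrib_left[symmetric] mult.assoc)
  qed
  have "a_coeff k (Suc m) ?\<mu> = - (1/2) *
    (\<Sum>\<alpha> = 0..m. \<Sum>\<beta> = 0..m - \<alpha>.
      (-1) ^ (Suc m + \<beta>) * real (lucas (m - \<beta>) \<alpha>) * ev k ^ (m - \<alpha> - \<beta>) *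
      (?K * (- ev k) ^ (\<beta> + (m + \<alpha>)) *
        (\<Sum>u\<le>d. c u * c (Suc u) * poly (pair_poly (2 * \<beta>) (2 * (m + \<alpha>))) (real u))))"
    unfolding a_coeff_def pair diff_Suc_1 ..
  also have "\<dots> = (\<Sum>\<alpha> = 0..m. \<Sum>\<beta> = 0..m - \<alpha>. \<Sum>u\<le>d. ?K / 2 * ev k ^ (2 * m) * (c u * c (Suc u) *
      ((- 1) ^ \<alpha> * real (lucas (m - \<beta>) \<alpha>) * poly (pair_poly (2 * \<beta>) (2 * (m + \<alpha>))) (real u))))"
    unfolding sum_distrib_left
  proof (intro sum.cong refl)
    fix \<alpha> \<beta> u assume ab: "\<alpha> \<in> {0..m}" "\<beta> \<in> {0..m - \<alpha>}"
    have 1: "ev k ^ (m - \<alpha> - \<beta>) * ev k ^ (\<beta> + (m + \<alpha>)) = ev k ^ (2 * m)"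
      unfolding power_add[symmetric] by (rule arg_cong[of _ _ "\<lambda>i. ev k ^ i"]) (use ab in auto)
    have "Suc m + \<beta> + (\<beta> + (m + \<alpha>)) = Suc \<alpha> + 2 * (m + \<beta>)" by simp
    then have "((-1)::real) ^ (Suc m + \<beta> + (\<beta> + (m + \<alpha>))) = (-1) ^ Suc \<alpha>"
      by (simp only: power_add[of _ "Suc \<alpha>"] power_mult power2_minus one_power2 power_one mult_1_right)
    then have 2: "((-1)::real) ^ (Suc m + \<beta>) * (-1) ^ (\<beta> + (m + \<alpha>)) = - ((-1) ^ \<alpha>)"
      by (simp add: power_add)
    let ?P = "c u * c (Suc u) * poly (pair_poly (2 * \<beta>) (2 * (m + \<alpha>))) (real u)"
    let ?L = "real (lucas (m - \<beta>) \<alpha>)"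
    have "- (1/2) * ((-1) ^ (Suc m + \<beta>) * ?L * ev k ^ (m - \<alpha> - \<beta>) * (?K * (- ev k) ^ (\<beta> + (m + \<alpha>)) * ?P))
      = - (1/2) * ?L * ?K * ?P * ((-1) ^ (Suc m + \<beta>) * (-1) ^ (\<beta> + (m + \<alpha>)))
        * (ev k ^ (m - \<alpha> - \<beta>) * ev k ^ (\<beta> + (m + \<alpha>)))"
      unfolding power_minus[of "ev k"] by (simp only: mult_ac)
    also have "\<dots> = ?K / 2 * ev k ^ (2 * m) * (c u * c (Suc u) *
      ((- 1) ^ \<alpha> * ?L * poly (pair_poly (2 * \<beta>) (2 * (m + \<alpha>))) (real u)))"
      unfolding 1 2 by (simp add: mult_ac)
    finally show "- (1/2) * ((-1) ^ (Suc m + \<beta>) * ?L * ev k ^ (m - \<alpha> - \<beta>) * (?K * (- ev k) ^ (\<beta> + (m + \<alpha>)) * ?P))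
      = ?K / 2 * ev k ^ (2 * m) * (c u * c (Suc u) *
      ((- 1) ^ \<alpha> * ?L * poly (pair_poly (2 * \<beta>) (2 * (m + \<alpha>))) (real u)))" .
  qed
  also have "\<dots> = (\<Sum>u\<le>d. \<Sum>\<alpha> = 0..m. \<Sum>\<beta> = 0..m - \<alpha>. ?K / 2 * ev k ^ (2 * m) * (c u * c (Suc u) *
      ((- 1) ^ \<alpha> * real (lucas (m - \<beta>) \<alpha>) * poly (pair_poly (2 * \<beta>) (2 * (m + \<alpha>))) (real u))))"
  proof -
    have "(\<Sum>\<beta>\<in>B. \<Sum>u\<le>d. f \<beta> u) = (\<Sum>u\<le>d. \<Sum>\<beta>\<in>B. f \<beta> u)" for B :: "nat set" and f :: "nat \<Rightarrow> nat \<Rightarrow> real"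
      by (rule sum.swap)
    then show ?thesis by simp
  qed
  also have "\<dots> = ?K / 2 * ev k ^ (2 * m) * (\<Sum>u\<le>d. c u * c (Suc u) * poly (lucas_poly m) (real u))"
    unfolding lucas_poly_def poly_sum poly_smult sum_distrib_left ..
  finally show ?thesis .
qed

text \<open>Coefficients whose consecutive products are the prescribed values \<open>p u\<close>, as long as these are nonzero.\<close>

fun chain_coeff :: "(nat \<Rightarrow> real) \<Rightarrow> nat \<Rightarrow> real"
  where
    "chain_coeff p 0 = 1"
  | "chain_coeff p (Suc u) = p u / chain_coeff p u"

lemma chain_coeff_nonzero: "(\<And>v. v < u \<Longrightarrow> p v \<noteq> 0) \<Longrightarrow> chain_coeff p u \<noteq> 0"
  by (induction u) auto

lemma chain_coeff_product: "(\<And>v. v < u \<Longrightarrow> p v \<noteq> 0) \<Longrightarrow> chain_coeff p u * chain_coeff p (Suc u) = p u"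
  using chain_coeff_nonzero[of u p] by simp

theorem proposition1p6:
  fixes k N :: nat
  assumes "k \<ge> 1" and "N \<ge> 2"
  shows "\<exists>\<mu> \<in> dom_A_inf. inner_L2 \<mu> (ef k) = 0 \<and>
    (\<forall>n \<in> {1..N - 1}. a_coeff k n \<mu> = 0) \<and> a_coeff k N \<mu> \<noteq> 0"
proof -
  \<comment> \<open>The degree of \<open>lucas_poly (N - 1)\<close>, and the order of the finite difference that detects it.\<close>
  define d where "d = 4 * (N - 1)"
  define p where "p u = (- 1) ^ u * real (d choose u)" for u
  define \<mu> where "\<mu> = sine_sum {..Suc d} (\<lambda>u. k * (u + 2)) (chain_coeff p)"
  have prod: "chain_coeff p u * chain_coeff p (Suc u) = p u" if "u \<le> d" for u
    by (rule chain_coeff_product) (use that in \<open>auto simp: p_def\<close>)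
  have a: "a_coeff k (Suc m) \<mu> = real k * pi / sqrt 2 / 2 * ev k ^ (2 * m) *
      ((- 1) ^ d * fact d * coeff (lucas_poly m) d)" if "m \<le> N - 1" for m
  proof -
    have "degree (lucas_poly m) \<le> d"
      using degree_lucas_poly[of m] that by (simp add: d_def)
    then have "(\<Sum>u\<le>d. p u * poly (lucas_poly m) (real u)) = (- 1) ^ d * fact d * coeff (lucas_poly m) d"
      unfolding p_def by (rule alternating_binomial_poly_sum)
    then show ?thesis
      using prod unfolding \<mu>_def a_coeff_sine_sum[OF assms(1)] by (simp del: chain_coeff.simps)
  qed
  have "inner_L2 \<mu> (ef k) = 0"
    unfolding \<mu>_def by (rule inner_sine_sum_ef_eq_0) (use assms(1) in auto)
  moreover have "a_coeff k n \<mu> = 0" if "n \<in> {1..N - 1}" for n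
  proof -
    obtain m where m: "n = Suc m" using \<open>n \<in> {1..N - 1}\<close> by (cases n) auto
    then have "degree (lucas_poly m) < d"
      using that by (intro le_less_trans[OF degree_lucas_poly]) (auto simp: d_def)
    then show ?thesis using a[of m] that by (simp add: m coeff_eq_0)
  qed
  moreover have "a_coeff k N \<mu> \<noteq> 0"
  proof -
    have "a_coeff k (Suc (N - 1)) \<mu> \<noteq> 0"
      using a[of "N - 1"] assms coeff_lucas_poly[of "N - 1"] by (simp add: d_def ev_def)
    then show ?thesis using assms(2) by simp
  qed
  moreover have "\<mu> \<in> dom_A_inf"
    unfolding \<mu>_def by (rule sine_sum_in_dom_A_inf) simp
  ultimately show ?thesis by blast
qed

end
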